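(* Let $r > 2$ and let $m_1,\dots,m_r$ be positive integers. Then $\Delta L(K_{m_1,\ldots,m_r})$ is homotopy equivalent to a wedge of $2$-dimensional spheres.
   Context: The complete multipartite graph $K_{m_1,\dots,m_r}$ has vertex set $A_1 \sqcup \cdots \sqcup A_r$ with $|A_i| = m_i$, two vertices adjacent iff they lie in different parts. The clique complex $\Delta(G)$ of a graph $G$ is the simplicial complex whose simplices are the vertex subsets inducing complete subgraphs. The line graph $L(G)$ has vertex set $E(G)$, two edges being adjacent iff they share exactly one endpoint; $\Delta L(G) = \Delta(L(G))$. A wedge of zero spheres is a point. *)

theory Defs
  imports "HOL-Analysis.Analysis"
begin

text \<open>Simple graphs: edges are two-element sets of vertices.\<close>

record 'a ugraph =
  verts :: "'a set"
  edges :: "'a set set"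

definition complete_multipartite :: "nat \<Rightarrow> (nat \<Rightarrow> nat) \<Rightarrow> (nat \<times> nat) ugraph" where
  "complete_multipartite r m =
     (let V = (SIGMA i:{1..r}. {1..m i})
      in \<lparr>verts = V, edges = {{u, v} | u v. u \<in> V \<and> v \<in> V \<and> fst u \<noteq> fst v}\<rparr>)"

definition line_graph :: "'a ugraph \<Rightarrow> 'a set ugraph" where
  "line_graph G =
     \<lparr>verts = edges G,
      edges = {{e, f} | e f. e \<in> edges G \<and> f \<in> edges G \<and> card (e \<inter> f) = 1}\<rparr>"

definition clique_complex :: "'a ugraph \<Rightarrow> 'a set set" where
  "clique_complex G =
     {S. S \<subseteq> verts G \<and> finite S \<and> S \<noteq> {} \<and>
         (\<forall>u\<in>S. \<forall>v\<in>S. u \<noteq> v \<longrightarrow> {u, v} \<in> edges G)}"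

text \<open>
  Points of the realization are given by barycentric coordinates.  The topology is that of
  pointwise convergence; for complexes on a finite vertex set, the only ones considered here, it
  coincides with the weak topology determined by the closed simplices.
\<close>

definition geometric_realization :: "'a set set \<Rightarrow> ('a \<Rightarrow> real) topology" where
  "geometric_realization K =
     subtopology (powertop_real UNIV)
       {x. (\<forall>v. 0 \<le> x v) \<and> {v. x v \<noteq> 0} \<in> K \<and> (\<Sum>v | x v \<noteq> 0. x v) = 1}"

text \<open>
  The wedge of the pointed spaces \<open>(X i, p i)\<close>, \<open>i \<in> I\<close>: all base points become the single point
  \<^term>\<open>None\<close>, and the topology is the final one for the inclusions of the summands.  The base
  point is always present, so that the empty wedge is a one-point space.
\<close>

definition wedge_incl :: "('i \<Rightarrow> 'a) \<Rightarrow> 'i \<Rightarrow> 'a \<Rightarrow> ('i \<times> 'a) option" where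
  "wedge_incl p i x = (if x = p i then None else Some (i, x))"

definition wedge :: "'i set \<Rightarrow> ('i \<Rightarrow> 'a topology) \<Rightarrow> ('i \<Rightarrow> 'a) \<Rightarrow> ('i \<times> 'a) option topology" where
  "wedge I X p =
     topology (\<lambda>U. U \<subseteq> insert None (\<Union>i\<in>I. wedge_incl p i ` topspace (X i)) \<and>
                   (\<forall>i\<in>I. openin (X i) {x \<in> topspace (X i). wedge_incl p i x \<in> U}))"

lemma openin_wedge:
  "openin (wedge I X p) U \<longleftrightarrow>
     U \<subseteq> insert None (\<Union>i\<in>I. wedge_incl p i ` topspace (X i)) \<and>
     (\<forall>i\<in>I. openin (X i) {x \<in> topspace (X i). wedge_incl p i x \<in> U})"
proof -
  have inter: "{x \<in> topspace (X i). wedge_incl p i x \<in> S \<inter> T} =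
      {x \<in> topspace (X i). wedge_incl p i x \<in> S} \<inter> {x \<in> topspace (X i). wedge_incl p i x \<in> T}"
    for i S T by auto
  have Union: "{x \<in> topspace (X i). wedge_incl p i x \<in> \<Union>\<K>} =
      (\<Union>S\<in>\<K>. {x \<in> topspace (X i). wedge_incl p i x \<in> S})" for i \<K> by auto
  have "istopology (\<lambda>U. U \<subseteq> insert None (\<Union>i\<in>I. wedge_incl p i ` topspace (X i)) \<and>
                   (\<forall>i\<in>I. openin (X i) {x \<in> topspace (X i). wedge_incl p i x \<in> U}))"
    unfolding istopology_def inter Union
    by (intro conjI allI impI ballI openin_Int openin_Union) auto
  then show ?thesis
    by (simp add: wedge_def topology_inverse')
qed

lemma topspace_wedge:
  "topspace (wedge I X p) = insert None (\<Union>i\<in>I. wedge_incl p i ` topspace (X i))"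
proof -
  have "{x \<in> topspace (X i). wedge_incl p i x \<in> insert None (\<Union>i\<in>I. wedge_incl p i ` topspace (X i))}
      = topspace (X i)" if "i \<in> I" for i
    using that by auto
  then have "openin (wedge I X p) (insert None (\<Union>i\<in>I. wedge_incl p i ` topspace (X i)))"
    by (simp add: openin_wedge)
  then show ?thesis
    using openin_subset openin_wedge[of I X p "topspace (wedge I X p)"] by fastforce
qed

definition wedge_of_spheres :: "nat \<Rightarrow> nat \<Rightarrow> (nat \<times> (nat \<Rightarrow> real)) option topology" where
  "wedge_of_spheres d k =
     wedge {..<k} (\<lambda>_. nsphere d) (\<lambda>_ j. if j = 0 then 1 else 0)"

lemma base_point_in_nsphere: "(\<lambda>j. if j = 0 then 1 else 0) \<in> topspace (nsphere d)"
  by (simp add: nsphere if_distrib[of "\<lambda>x. x ^ 2"] sum.delta cong: if_cong)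

end

theory Submission
  imports Defs
begin

text \<open>
  A clique of the line graph is contained in the set of edges at a vertex or is a triangle, so the
  complex \<open>K\<close> in question consists of the full simplices on the stars together with triangles whose
  boundaries lie in stars. Let \<open>L\<close> contain all stars and one triangle for each edge of a set \<open>M\<close>,
  chosen so that these edges can be removed one after the other, each lying in only one remaining
  triangle: with \<open>a\<close>, \<open>b\<close>, \<open>c\<close> in the parts 1, 2, 3, an edge avoiding part 1 is coned off to \<open>a\<close>,
  and an edge from \<open>a' \<noteq> a\<close> in part 1 to \<open>v \<noteq> b\<close> is completed by \<open>c\<close> if \<open>v\<close> lies in part 2 and by \<open>b\<close>
  otherwise. The removals are collapses, and they leave the stars of \<open>a\<close> and of \<open>b\<close> restricted to
  part 1, a cone with apex \<open>{a, b}\<close>. Hence \<open>L\<close> is contractible, and since \<open>K\<close> arises from \<open>L\<close> by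
  attaching triangles, \<open>K\<close> is homotopy equivalent to \<open>K/L\<close>, a wedge of 2-spheres.
\<close>

subsection \<open>Polyhedra of finite complexes\<close>

definition simplicial_complex :: "'a set set \<Rightarrow> bool" where
  "simplicial_complex K \<longleftrightarrow>
     finite K \<and> (\<forall>S\<in>K. finite S \<and> S \<noteq> {} \<and> (\<forall>T. T \<subseteq> S \<and> T \<noteq> {} \<longrightarrow> T \<in> K))"

definition closed_simplex :: "'a set \<Rightarrow> ('a \<Rightarrow> real) set" where
  "closed_simplex S = {x. (\<forall>v. 0 \<le> x v) \<and> (\<forall>v. v \<notin> S \<longrightarrow> x v = 0) \<and> sum x S = 1}"

text \<open>The union form gives the finite closed covers used for compactness and pasting;
  \<open>mem_underlying_space_iff_support\<close> identifies it with the point set behind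
  \<open>geometric_realization\<close>.\<close>

definition underlying_space :: "'a set set \<Rightarrow> ('a \<Rightarrow> real) set" where
  "underlying_space K = (\<Union>S\<in>K. closed_simplex S)"

lemma simplicial_complexD:
  assumes "simplicial_complex K"
  shows "finite K" and "S \<in> K \<Longrightarrow> finite S" and "S \<in> K \<Longrightarrow> S \<noteq> {}"
    and "S \<in> K \<Longrightarrow> T \<subseteq> S \<Longrightarrow> T \<noteq> {} \<Longrightarrow> T \<in> K"
  using assms unfolding simplicial_complex_def by blast+

lemma mem_underlying_space_iff_support:
  assumes "simplicial_complex K"
  shows "x \<in> underlying_space K \<longleftrightarrow>
    (\<forall>v. 0 \<le> x v) \<and> {v. x v \<noteq> 0} \<in> K \<and> (\<Sum>v | x v \<noteq> 0. x v) = 1"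
proof
  assume "x \<in> underlying_space K"
  then obtain S where S: "S \<in> K" "\<And>v. 0 \<le> x v" "\<And>v. v \<notin> S \<Longrightarrow> x v = 0" "sum x S = 1"
    unfolding underlying_space_def closed_simplex_def by blast
  have sub: "{v. x v \<noteq> 0} \<subseteq> S"
    using S(3) by blast
  have fin: "finite S"
    using simplicial_complexD(2)[OF assms] S(1) .
  have sum: "(\<Sum>v | x v \<noteq> 0. x v) = 1"
    unfolding S(4)[symmetric] by (rule sum.mono_neutral_left) (use fin sub in auto)
  then have "{v. x v \<noteq> 0} \<noteq> {}"
    by (metis sum.empty zero_neq_one)
  then show "(\<forall>v. 0 \<le> x v) \<and> {v. x v \<noteq> 0} \<in> K \<and> (\<Sum>v | x v \<noteq> 0. x v) = 1"
    using S(2) sum simplicial_complexD(4)[OF assms S(1) sub] by blast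
next
  assume "(\<forall>v. 0 \<le> x v) \<and> {v. x v \<noteq> 0} \<in> K \<and> (\<Sum>v | x v \<noteq> 0. x v) = 1"
  then show "x \<in> underlying_space K"
    unfolding underlying_space_def closed_simplex_def by blast
qed

lemma geometric_realization_eq:
  assumes "simplicial_complex K"
  shows "geometric_realization K = top_of_set (underlying_space K)"
proof -
  have "{x. (\<forall>v. 0 \<le> x v) \<and> {v. x v \<noteq> 0} \<in> K \<and> (\<Sum>v | x v \<noteq> 0. x v) = 1} = underlying_space K"
    using mem_underlying_space_iff_support[OF assms] by blast
  then show ?thesis
    by (simp add: geometric_realization_def euclidean_product_topology)
qed

lemma continuous_on_Min_finite:
  fixes f :: "'i \<Rightarrow> 'a::topological_space \<Rightarrow> real"
  assumes "finite I" "I \<noteq> {}" "\<And>i. i \<in> I \<Longrightarrow> continuous_on A (f i)"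
  shows "continuous_on A (\<lambda>x. Min ((\<lambda>i. f i x) ` I))"
  using assms
proof (induction I rule: finite_ne_induct)
  case (insert i I)
  then show ?case
    by (simp add: continuous_on_min)
qed simp

lemma continuous_on_Min_coordinates [continuous_intros]:
  fixes f :: "'b::topological_space \<Rightarrow> 'a \<Rightarrow> real"
  assumes "finite S" "S \<noteq> {}" "continuous_on A f"
  shows "continuous_on A (\<lambda>x. Min (f x ` S))"
  using continuous_on_Min_finite[OF assms(1,2), of A "\<lambda>i x. f x i"]
    continuous_on_product_then_coordinatewise[OF assms(3)] by (simp add: image_def)

lemma closed_simplex_mono:
  assumes "S \<subseteq> T" "finite T"
  shows "closed_simplex S \<subseteq> closed_simplex T"
proof
  fix x :: "'a \<Rightarrow> real"
  assume x: "x \<in> closed_simplex S"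
  then have "sum x T = sum x S"
    using assms by (intro sum.mono_neutral_right) (auto simp: closed_simplex_def)
  then show "x \<in> closed_simplex T"
    using x assms by (auto simp: closed_simplex_def)
qed

lemma closed_simplex_face:
  assumes "x \<in> closed_simplex S" "finite S" "\<And>v. v \<in> S - T \<Longrightarrow> x v = 0" "T \<subseteq> S"
  shows "x \<in> closed_simplex T"
proof -
  have "sum x S = sum x T"
    using assms by (intro sum.mono_neutral_right) auto
  then show ?thesis
    using assms by (auto simp: closed_simplex_def)
qed

text \<open>Tychonoff for the box with factor [0, 1] over \<open>S\<close> and {0} elsewhere, cut
  down by the closed condition on the sum.\<close>

lemma compact_closed_simplex:
  assumes "finite S"
  shows "compact (closed_simplex S)"
proof -
  let ?P = "PiE UNIV (\<lambda>v. if v \<in> S then {0..1} else {0::real})"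
  have "compactin (powertop_real UNIV) ?P"
    by (subst compactin_PiE) auto
  then have "compact ?P"
    by (simp add: euclidean_product_topology)
  moreover have "closed {x :: 'a \<Rightarrow> real. sum x S = 1}"
    by (intro closed_Collect_eq continuous_intros) auto
  moreover have "closed_simplex S = ?P \<inter> {x. sum x S = 1}" (is "_ = ?R")
  proof (rule set_eqI)
    fix x
    have "x v \<le> 1" if "x \<in> closed_simplex S" "v \<in> S" for v
      using that member_le_sum[of v S x] assms by (auto simp: closed_simplex_def)
    then show "x \<in> closed_simplex S \<longleftrightarrow> x \<in> ?R"
      by (fastforce simp: closed_simplex_def PiE_iff split: if_splits)
  qed
  ultimately show ?thesis
    by (simp add: compact_Int_closed)
qed

lemma closed_closed_simplex: "closed (closed_simplex S)"
proof -
  have "continuous_on UNIV (\<lambda>x :: 'a \<Rightarrow> real. x v)" for v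
    by simp
  then show ?thesis
    unfolding closed_simplex_def
    by (intro closed_Collect_conj closed_Collect_all closed_Collect_imp closed_Collect_le
        closed_Collect_eq continuous_on_sum continuous_on_const open_Collect_const)
qed

lemma closed_underlying_space:
  assumes "simplicial_complex K"
  shows "closed (underlying_space K)"
  unfolding underlying_space_def
  using simplicial_complexD(1)[OF assms] closed_closed_simplex by (intro closed_UN) auto

lemma compact_underlying_space:
  assumes "simplicial_complex K"
  shows "compact (underlying_space K)"
  unfolding underlying_space_def
  using simplicial_complexD(1,2)[OF assms] by (intro compact_UN compact_closed_simplex) auto

subsection \<open>Collapses\<close>

text \<open>A linear deformation that is the identity at \<open>t = 0\<close>. The factor
  \<open>card \<sigma>\<close> preserves the sum of the coordinates, and points with a vanishing
  coordinate on \<open>\<sigma>\<close> stay fixed because the minimum is then 0.\<close>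

definition push :: "'a set \<Rightarrow> 'a \<Rightarrow> real \<Rightarrow> ('a \<Rightarrow> real) \<Rightarrow> 'a \<Rightarrow> real" where
  "push \<sigma> v t x =
     (\<lambda>u. x u - t * Min (x ` \<sigma>) * of_bool (u \<in> \<sigma>) + t * card \<sigma> * Min (x ` \<sigma>) * of_bool (u = v))"

lemma push_mem_closed_simplex:
  assumes "finite S" "\<sigma> \<subseteq> S" "\<sigma> \<noteq> {}" "x \<in> closed_simplex S" "0 \<le> t" "t \<le> 1"
  shows "push \<sigma> v t x \<in> closed_simplex (insert v S)"
proof -
  let ?s = "Min (x ` \<sigma>)"
  have fin: "finite \<sigma>"
    using assms finite_subset by blast
  have x: "x \<in> closed_simplex (insert v S)"
    using closed_simplex_mono[of S "insert v S"] assms by blast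
  have s0: "0 \<le> ?s"
    using x fin assms by (simp add: closed_simplex_def)
  have s1: "t * ?s \<le> x u" if "u \<in> \<sigma>" for u
  proof -
    have "t * ?s \<le> ?s"
      using s0 assms by (simp add: mult_left_le_one_le)
    then show ?thesis
      using Min_le[of "x ` \<sigma>" "x u"] that fin by (meson finite_imageI imageI order_trans)
  qed
  have "0 \<le> push \<sigma> v t x u" for u
    unfolding push_def using s0 s1[of u] x assms
    by (auto simp: of_bool_def closed_simplex_def intro!: add_nonneg_nonneg)
  moreover have "push \<sigma> v t x u = 0" if "u \<notin> insert v S" for u
    using that x assms by (auto simp: push_def closed_simplex_def)
  moreover have "sum (push \<sigma> v t x) (insert v S) = 1"
  proof -
    have "(\<Sum>u\<in>insert v S. t * ?s * of_bool (u \<in> \<sigma>)) = t * ?s * card \<sigma>"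
      unfolding sum_distrib_left[symmetric]
      using assms by (simp add: of_bool_def sum.If_cases Int_absorb1 subset_insertI2 Collect_mem_eq)
    moreover have "(\<Sum>u\<in>insert v S. t * card \<sigma> * ?s * of_bool (u = v)) = t * card \<sigma> * ?s"
      unfolding sum_distrib_left[symmetric] using assms by (simp add: of_bool_def)
    moreover have "sum x (insert v S) = 1"
      using x by (simp add: closed_simplex_def)
    ultimately show ?thesis
      by (simp add: push_def sum.distrib sum_subtractf)
  qed
  ultimately show ?thesis
    by (simp add: closed_simplex_def)
qed

lemma Min_coordinates_eq_0:
  assumes "finite \<sigma>" "\<not> \<sigma> \<subseteq> S" "x \<in> closed_simplex S"
  shows "Min (x ` \<sigma>) = 0"
proof (rule Min_eqI)
  show "0 \<in> x ` \<sigma>"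
    using assms by (force simp: closed_simplex_def)
qed (use assms in \<open>auto simp: closed_simplex_def\<close>)

lemma push_eq_id:
  assumes "finite \<sigma>" "\<not> \<sigma> \<subseteq> S" "x \<in> closed_simplex S"
  shows "push \<sigma> v t x = x"
  using Min_coordinates_eq_0[OF assms] by (simp add: push_def)

lemma continuous_on_push:
  assumes "finite \<sigma>" "\<sigma> \<noteq> {}"
  shows "continuous_on UNIV (\<lambda>(t, x). push \<sigma> v t x)"
  unfolding push_def case_prod_unfold
  by (intro continuous_on_coordinatewise_then_product continuous_intros assms
      continuous_on_product_then_coordinatewise[OF continuous_on_snd])

text \<open>The retraction pushes the smallest coordinate of \<open>\<sigma>\<close> onto \<open>v\<close>.\<close>

proposition homotopy_equivalent_deletion:
  assumes K: "simplicial_complex K" and \<sigma>: "finite \<sigma>" "\<sigma> \<noteq> {}" "v \<notin> \<sigma>"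
    and cone: "\<And>\<rho>. \<rho> \<in> K \<Longrightarrow> \<sigma> \<subseteq> \<rho> \<Longrightarrow> insert v \<rho> \<in> K"
  shows "top_of_set (underlying_space K) homotopy_equivalent_space
         top_of_set (underlying_space {\<rho> \<in> K. \<not> \<sigma> \<subseteq> \<rho>})" (is "?X homotopy_equivalent_space ?Y")
proof (rule deformation_retract_imp_homotopy_equivalent_space)
  let ?K' = "{\<rho> \<in> K. \<not> \<sigma> \<subseteq> \<rho>}"
  have maps: "push \<sigma> v t x \<in> underlying_space K" if t: "0 \<le> t" "t \<le> 1" and x: "x \<in> underlying_space K" for t x
  proof -
    obtain S where S: "S \<in> K" "x \<in> closed_simplex S"
      using x by (auto simp: underlying_space_def)
    show ?thesis
    proof (cases "\<sigma> \<subseteq> S")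
      case True
      then have "push \<sigma> v t x \<in> closed_simplex (insert v S)"
        using push_mem_closed_simplex[OF simplicial_complexD(2)[OF K S(1)] True \<sigma>(2) S(2) t] by simp
      then show ?thesis
        using cone S True by (auto simp: underlying_space_def)
    next
      case False
      then show ?thesis
        using push_eq_id[OF \<sigma>(1) False S(2)] x by simp
    qed
  qed
  have retr: "push \<sigma> v 1 x \<in> underlying_space ?K'" if x: "x \<in> underlying_space K" for x
  proof -
    obtain S where S: "S \<in> K" "x \<in> closed_simplex S"
      using x by (auto simp: underlying_space_def)
    show ?thesis
    proof (cases "\<sigma> \<subseteq> S")
      case True
      \<comment> \<open>A vertex \<open>u\<close> attaining the minimum loses all its weight at time
        1. The image lies in the face opposite \<open>u\<close>, which does not contain
        \<open>\<sigma>\<close> and is nonempty because it contains \<open>v\<close>.\<close>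
      have "Min (x ` \<sigma>) \<in> x ` \<sigma>"
        using \<sigma> by (intro Min_in) auto
      then obtain u where u: "u \<in> \<sigma>" "x u = Min (x ` \<sigma>)"
        by fastforce
      have fin: "finite (insert v S)"
        using simplicial_complexD(2)[OF K] S by blast
      have "push \<sigma> v 1 x \<in> closed_simplex (insert v S - {u})"
      proof (rule closed_simplex_face)
        show "push \<sigma> v 1 x \<in> closed_simplex (insert v S)"
          using push_mem_closed_simplex[OF simplicial_complexD(2)[OF K S(1)] True \<sigma>(2) S(2)] by simp
        show "push \<sigma> v 1 x w = 0" if "w \<in> insert v S - (insert v S - {u})" for w
          using that u \<sigma> by (auto simp: push_def)
      qed (use fin in auto)
      moreover have "insert v S - {u} \<in> ?K'"
        using simplicial_complexD(4)[OF K cone[OF S(1) True], of "insert v S - {u}"] u \<sigma>(3) by auto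
      ultimately show ?thesis
        unfolding underlying_space_def by blast
    next
      case False
      then show ?thesis
        using push_eq_id[OF \<sigma>(1) False S(2)] S by (auto simp: underlying_space_def)
    qed
  qed
  have cont: "continuous_on A (\<lambda>(t, x). push \<sigma> v t x)" for A
    using continuous_on_push[OF \<sigma>(1,2)] continuous_on_subset by blast
  have "homotopic_with (\<lambda>x. True) ?X ?X id (push \<sigma> v 1)"
    unfolding homotopic_with_def
  proof (intro exI conjI allI ballI)
    show "continuous_map (prod_topology (top_of_set {0..1}) ?X) ?X (\<lambda>(t, x). push \<sigma> v t x)"
      using cont maps by auto
  qed (auto simp: push_def)
  then show "homotopic_with (\<lambda>x. True) ?X ?X (push \<sigma> v 1) id"
    by (simp add: homotopic_with_sym)
  have "continuous_on A (\<lambda>x. push \<sigma> v 1 x)" for A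
    using continuous_on_compose2[OF cont[of UNIV], of A "\<lambda>x. (1, x)"]
    by (simp add: continuous_intros)
  moreover have "underlying_space ?K' \<subseteq> underlying_space K"
    by (auto simp: underlying_space_def)
  moreover have "push \<sigma> v 1 x = x" if "x \<in> underlying_space ?K'" for x
    using that push_eq_id[OF \<sigma>(1)] unfolding underlying_space_def by blast
  ultimately show "retraction_maps ?X ?Y (push \<sigma> v 1) id"
    using retr by (auto simp: retraction_maps_def image_subset_iff)
qed

text \<open>Contraction along straight lines to the vertex \<open>v\<close>: the segment from a
  point of \<open>\<rho>\<close> to the apex stays in the simplex
  \<open>insert v \<rho>\<close>.\<close>

lemma contractible_cone:
  assumes K: "simplicial_complex K" and "{v} \<in> K" and cone: "\<And>\<rho>. \<rho> \<in> K \<Longrightarrow> insert v \<rho> \<in> K"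
  shows "contractible (underlying_space K)"
proof -
  define h :: "real \<Rightarrow> ('a \<Rightarrow> real) \<Rightarrow> 'a \<Rightarrow> real"
    where "h = (\<lambda>t x u. (1 - t) * x u + t * of_bool (u = v))"
  have "h t x \<in> underlying_space K" if t: "0 \<le> t" "t \<le> 1" and x: "x \<in> underlying_space K" for t x
  proof -
    obtain S where S: "S \<in> K" "x \<in> closed_simplex S"
      using x by (auto simp: underlying_space_def)
    have fin: "finite (insert v S)"
      using simplicial_complexD(2)[OF K] S by blast
    then have x: "x \<in> closed_simplex (insert v S)"
      using closed_simplex_mono[of S "insert v S"] S by blast
    then have "sum (h t x) (insert v S) = (1 - t) + t"
      unfolding h_def sum.distrib sum_distrib_left[symmetric]
      using fin by (simp add: closed_simplex_def of_bool_def)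
    then have "h t x \<in> closed_simplex (insert v S)"
      using x t by (simp add: closed_simplex_def h_def)
    then show ?thesis
      using cone[OF S(1)] by (auto simp: underlying_space_def)
  qed
  moreover have "continuous_on A (\<lambda>(t, x). h t x)" for A
    unfolding h_def case_prod_unfold
    by (intro continuous_on_coordinatewise_then_product continuous_intros
        continuous_on_product_then_coordinatewise[OF continuous_on_snd])
  ultimately have "homotopic_with (\<lambda>x. True) (top_of_set (underlying_space K)) (top_of_set (underlying_space K))
      id (\<lambda>x u. of_bool (u = v))"
    unfolding homotopic_with_def
    by (intro exI[of _ "\<lambda>(t, x). h t x"]) (auto simp: h_def)
  then show ?thesis
    by (auto simp: contractible_def)
qed

subsection \<open>Quotients by deformable fibres\<close>

text \<open>The final stage of \<open>H\<close> is constant on the fibres of \<open>f\<close>, so it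
  descends to a homotopy inverse \<open>g\<close>. Then \<open>H\<close> deforms the identity to
  \<open>g \<circ> f\<close>, and the descent of \<open>f \<circ> H\<close> deforms the identity to
  \<open>f \<circ> g\<close>.\<close>

proposition homotopy_equivalent_quotient:
  fixes H :: "real \<times> 'a \<Rightarrow> 'a"
  assumes X: "compact_space X" and Y: "Hausdorff_space Y"
    and f: "continuous_map X Y f" "f ` topspace X = topspace Y"
    and H: "continuous_map (prod_topology (top_of_set {0..1}) X) X H"
    and H0: "\<And>x. x \<in> topspace X \<Longrightarrow> H (0, x) = x"
    and H1: "\<And>x y. x \<in> topspace X \<Longrightarrow> y \<in> topspace X \<Longrightarrow> f x = f y \<Longrightarrow> H (1, x) = H (1, y)"
    and Ht: "\<And>t x y. t \<in> {0..1} \<Longrightarrow> x \<in> topspace X \<Longrightarrow> y \<in> topspace X \<Longrightarrow> f x = f y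
              \<Longrightarrow> f (H (t, x)) = f (H (t, y))"
  shows "X homotopy_equivalent_space Y"
proof -
  let ?I = "top_of_set {0..1::real}"
  have q: "quotient_map X Y f"
    using continuous_imp_quotient_map[OF f(1) X Y f(2)] .
  \<comment> \<open>A continuous surjection from a compact onto a Hausdorff space is a quotient map;
    applied to the product with the interval, this makes the descended homotopy \<open>G\<close>
    continuous.\<close>
  have "quotient_map (prod_topology ?I X) (prod_topology ?I Y) (\<lambda>(t, x). (t, f x))"
  proof (rule continuous_imp_quotient_map)
    show "compact_space (prod_topology ?I X)"
      using X by (simp add: compact_space_prod_topology compact_space_subtopology)
    show "Hausdorff_space (prod_topology ?I Y)"
      using Y by (simp add: Hausdorff_space_prod_topology Hausdorff_space_subtopology)
    show "continuous_map (prod_topology ?I X) (prod_topology ?I Y) (\<lambda>(t, x). (t, f x))"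
      unfolding case_prod_unfold using f(1)
      by (intro continuous_map_pairedI continuous_map_fst continuous_map_compose[OF continuous_map_snd, unfolded o_def])
    show "(\<lambda>(t, x). (t, f x)) ` topspace (prod_topology ?I X) = topspace (prod_topology ?I Y)"
      unfolding topspace_prod_topology f(2)[symmetric] by force
  qed
  moreover have "continuous_map (prod_topology ?I X) Y (f \<circ> H)"
    using continuous_map_compose[OF H f(1)] .
  ultimately obtain G where G: "continuous_map (prod_topology ?I Y) Y G"
    and G_eq: "\<And>z. z \<in> topspace (prod_topology ?I X) \<Longrightarrow> G ((\<lambda>(t, x). (t, f x)) z) = (f \<circ> H) z"
  proof (rule quotient_map_lift_exists)
    show "(f \<circ> H) z = (f \<circ> H) w"
      if "z \<in> topspace (prod_topology ?I X)" "w \<in> topspace (prod_topology ?I X)"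
        "(\<lambda>(t, x). (t, f x)) z = (\<lambda>(t, x). (t, f x)) w" for z w
      using that Ht[of "fst z" "snd z" "snd w"] by (auto simp: case_prod_unfold)
  qed blast
  have one: "continuous_map X (prod_topology ?I X) (\<lambda>x. (1, x))"
    by (simp add: continuous_map_pairedI)
  have "continuous_map X X (H \<circ> (\<lambda>x. (1, x)))"
    using continuous_map_compose[OF one H] .
  then obtain g where g: "continuous_map Y X g"
    and g_eq: "\<And>x. x \<in> topspace X \<Longrightarrow> g (f x) = (H \<circ> (\<lambda>x. (1, x))) x"
  proof (rule quotient_map_lift_exists[OF q])
    show "(H \<circ> (\<lambda>x. (1, x))) x = (H \<circ> (\<lambda>x. (1, x))) y"
      if "x \<in> topspace X" "y \<in> topspace X" "f x = f y" for x y
      using H1[OF that] by simp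
  qed blast
  have "homotopic_with (\<lambda>x. True) X X id (g \<circ> f)"
    using H H0 g_eq by (subst homotopic_with) (auto intro!: exI[of _ H])
  moreover have "homotopic_with (\<lambda>x. True) Y Y id (f \<circ> g)"
  proof (subst homotopic_with, simp, intro exI conjI ballI)
    fix y assume "y \<in> topspace Y"
    then obtain x where x: "x \<in> topspace X" "y = f x"
      using f(2) by blast
    show "G (0, y) = id y" "G (1, y) = (f \<circ> g) y"
      using G_eq[of "(0, x)"] G_eq[of "(1, x)"] x H0 g_eq by simp_all
  qed (use G in auto)
  ultimately show ?thesis
    unfolding homotopy_equivalent_space_def using f(1) g
    by (intro exI[of _ f] exI[of _ g]) (simp add: homotopic_with_sym)
qed

subsection \<open>Wedges\<close>

text \<open>The retraction onto the summand \<open>i\<close> that collapses all other summands to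
  the base point; these maps serve to separate points of the wedge.\<close>

definition wedge_proj :: "('i \<Rightarrow> 'a) \<Rightarrow> 'i \<Rightarrow> ('i \<times> 'a) option \<Rightarrow> 'a" where
  "wedge_proj p i w = (case w of None \<Rightarrow> p i | Some (j, x) \<Rightarrow> if j = i then x else p i)"

lemma wedge_proj_wedge_incl: "wedge_proj p i (wedge_incl p j x) = (if i = j then x else p i)"
  by (simp add: wedge_proj_def wedge_incl_def)

lemma continuous_map_wedge_incl:
  "i \<in> I \<Longrightarrow> continuous_map (X i) (wedge I X p) (wedge_incl p i)"
  by (auto simp: continuous_map_def topspace_wedge openin_wedge)

text \<open>Openness in the wedge is tested on each summand, where the composite with the inclusion
  is either the identity or constant at the base point.\<close>

lemma continuous_map_wedge_proj:
  assumes "\<And>i. i \<in> I \<Longrightarrow> p i \<in> topspace (X i)" "i \<in> I"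
  shows "continuous_map (wedge I X p) (X i) (wedge_proj p i)"
proof -
  have "wedge_proj p i w \<in> topspace (X i)" if "w \<in> topspace (wedge I X p)" for w
    using that assms by (auto simp: topspace_wedge wedge_proj_wedge_incl) (simp add: wedge_proj_def)
  moreover have "openin (wedge I X p) {w \<in> topspace (wedge I X p). wedge_proj p i w \<in> U}"
    if U: "openin (X i) U" for U
    unfolding openin_wedge
  proof (intro conjI ballI)
    fix j assume j: "j \<in> I"
    have "{x \<in> topspace (X j). wedge_incl p j x \<in> {w \<in> topspace (wedge I X p). wedge_proj p i w \<in> U}}
        = {x \<in> topspace (X j). (if i = j then x else p i) \<in> U}"
      using j by (auto simp: topspace_wedge wedge_proj_wedge_incl)
    also have "openin (X j) \<dots>"
    proof (cases "i = j")
      case True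
      then have "{x \<in> topspace (X j). (if i = j then x else p i) \<in> U} = U"
        using openin_subset[OF U] by auto
      then show ?thesis
        using U True by simp
    next
      case False
      then show ?thesis
        by (cases "p i \<in> U") auto
    qed
    finally show "openin (X j) {x \<in> topspace (X j). wedge_incl p j x \<in>
        {w \<in> topspace (wedge I X p). wedge_proj p i w \<in> U}}" .
  qed (auto simp: topspace_wedge)
  ultimately show ?thesis
    by (auto simp: continuous_map_def)
qed

text \<open>Of two distinct points one is not the base point; the projection to its summand
  distinguishes them, and disjoint open sets are pulled back from there.\<close>

lemma Hausdorff_space_wedge:
  assumes "\<And>i. i \<in> I \<Longrightarrow> p i \<in> topspace (X i)" "\<And>i. i \<in> I \<Longrightarrow> Hausdorff_space (X i)"
  shows "Hausdorff_space (wedge I X p)"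
  unfolding Hausdorff_space_def
proof (intro allI impI, elim conjE)
  fix v w
  assume v: "v \<in> topspace (wedge I X p)" and w: "w \<in> topspace (wedge I X p)" and "v \<noteq> w"
  have "\<exists>i\<in>I. wedge_proj p i v \<noteq> wedge_proj p i w"
    using v w \<open>v \<noteq> w\<close> unfolding topspace_wedge
    by (auto simp: wedge_proj_def wedge_incl_def split: if_splits)
  then obtain i where i: "i \<in> I" "wedge_proj p i v \<noteq> wedge_proj p i w"
    by blast
  have cont: "continuous_map (wedge I X p) (X i) (wedge_proj p i)"
    using continuous_map_wedge_proj assms(1) i(1) by metis
  then have "wedge_proj p i v \<in> topspace (X i)" "wedge_proj p i w \<in> topspace (X i)"
    using v w by (auto simp: continuous_map_def)
  then obtain U V where UV: "openin (X i) U" "openin (X i) V" "wedge_proj p i v \<in> U"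
      "wedge_proj p i w \<in> V" "disjnt U V"
    using assms(2)[OF i(1)] i(2) unfolding Hausdorff_space_def by metis
  show "\<exists>U V. openin (wedge I X p) U \<and> openin (wedge I X p) V \<and> v \<in> U \<and> w \<in> V \<and> disjnt U V"
    using openin_continuous_map_preimage[OF cont UV(1)] openin_continuous_map_preimage[OF cont UV(2)]
      UV(3-) v w
    by (intro exI[of _ "{z \<in> topspace (wedge I X p). wedge_proj p i z \<in> U}"]
        exI[of _ "{z \<in> topspace (wedge I X p). wedge_proj p i z \<in> V}"]) (auto simp: disjnt_iff)
qed

subsection \<open>The triangle modulo its boundary\<close>

text \<open>For positive barycentric coordinates with minimum \<open>s\<close>, this is the inverse stereographic
  projection of the point \<open>((a - c) / s, (b - c) / s)\<close> of the plane, with denominators cleared.\<close>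

definition triangle_to_sphere :: "real \<Rightarrow> real \<Rightarrow> real \<Rightarrow> nat \<Rightarrow> real" where
  "triangle_to_sphere a b c =
     (let s = min a (min b c); q = (a - c)\<^sup>2 + (b - c)\<^sup>2
      in (\<lambda>j. if j = 0 then (q - s\<^sup>2) / (q + s\<^sup>2)
              else if j = 1 then 2 * s * (a - c) / (q + s\<^sup>2)
              else if j = 2 then 2 * s * (b - c) / (q + s\<^sup>2)
              else 0))"

text \<open>The three squares vanish together only for \<open>a = b = c = 0\<close>, which the sum 1
  excludes.\<close>

lemma triangle_denominator_pos:
  fixes a b c :: real
  assumes "a + b + c = 1"
  shows "(a - c)\<^sup>2 + (b - c)\<^sup>2 + (min a (min b c))\<^sup>2 > 0"
proof -
  have "a - c \<noteq> 0 \<or> b - c \<noteq> 0 \<or> min a (min b c) \<noteq> 0"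
    using assms by linarith
  then have "(a - c)\<^sup>2 > 0 \<or> (b - c)\<^sup>2 > 0 \<or> (min a (min b c))\<^sup>2 > 0"
    by (metis zero_less_power2)
  then show ?thesis
    by (smt (verit) zero_le_power2)
qed

lemma topspace_nsphere_2:
  "y \<in> topspace (nsphere 2) \<longleftrightarrow> (y 0)\<^sup>2 + (y 1)\<^sup>2 + (y 2)\<^sup>2 = 1 \<and> (\<forall>i>2. y i = 0)"
  by (simp add: nsphere numeral_2_eq_2)

text \<open>With \<open>q = p^2 + r^2\<close>, this is the identity
  \<open>(q - s^2)^2 + 4 * s^2 * q = (q + s^2)^2\<close>.\<close>

lemma triangle_to_sphere_mem:
  assumes "a + b + c = 1"
  shows "triangle_to_sphere a b c \<in> topspace (nsphere 2)"
proof -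
  define s p r where d: "s = min a (min b c)" "p = a - c" "r = b - c"
  define D where "D = p\<^sup>2 + r\<^sup>2 + s\<^sup>2"
  have D: "D > 0"
    using triangle_denominator_pos[OF assms] by (simp add: d D_def)
  have "((p\<^sup>2 + r\<^sup>2 - s\<^sup>2) / D)\<^sup>2 + (2 * s * p / D)\<^sup>2 + (2 * s * r / D)\<^sup>2
      = ((p\<^sup>2 + r\<^sup>2 - s\<^sup>2)\<^sup>2 + (2 * s * p)\<^sup>2 + (2 * s * r)\<^sup>2) / D\<^sup>2"
    by (simp add: power_divide add_divide_distrib)
  also have "(p\<^sup>2 + r\<^sup>2 - s\<^sup>2)\<^sup>2 + (2 * s * p)\<^sup>2 + (2 * s * r)\<^sup>2 = D\<^sup>2"
    unfolding D_def by algebra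
  finally show ?thesis
    using D unfolding topspace_nsphere_2
    by (simp add: triangle_to_sphere_def Let_def flip: d) (simp add: D_def)
qed

lemma triangle_to_sphere_boundary:
  assumes "a + b + c = 1" "min a (min b c) = 0"
  shows "triangle_to_sphere a b c = (\<lambda>j. if j = 0 then 1 else 0)"
  using triangle_denominator_pos[OF assms(1)]
  unfolding triangle_to_sphere_def Let_def assms(2) by (intro ext) auto

lemma triangle_to_sphere_interior:
  assumes "a + b + c = 1" "min a (min b c) > 0"
  shows "triangle_to_sphere a b c 0 \<noteq> 1"
proof -
  have "s > 0 \<Longrightarrow> (q - s\<^sup>2) / (q + s\<^sup>2) = 1 \<Longrightarrow> q + s\<^sup>2 > 0 \<Longrightarrow> False" for q s :: real
    by (simp add: divide_eq_eq)
  from this[OF assms(2)] show ?thesis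
    using triangle_denominator_pos[OF assms(1)] by (auto simp: triangle_to_sphere_def Let_def)
qed

text \<open>The coordinate at 0 determines \<open>s^2 / D\<close>; dividing the other two
  coordinates by it recovers the plane point. The minimum of its coordinates and 0 is
  \<open>1 - c / s\<close>, which yields \<open>c / s\<close>, and the normalization
  \<open>a + b + c = 1\<close> then yields \<open>1 / s\<close>.\<close>

lemma triangle_to_sphere_inj:
  assumes abc: "a + b + c = 1" "min a (min b c) > 0"
    and abc': "a' + b' + c' = 1" "min a' (min b' c') > 0"
    and eq: "triangle_to_sphere a b c = triangle_to_sphere a' b' c'"
  shows "a = a' \<and> b = b' \<and> c = c'"
proof -
  define s where "s = min a (min b c)"
  define s' where "s' = min a' (min b' c')"
  define D where "D = (a - c)\<^sup>2 + (b - c)\<^sup>2 + s\<^sup>2"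
  define D' where "D' = (a' - c')\<^sup>2 + (b' - c')\<^sup>2 + s'\<^sup>2"
  have pos: "s > 0" "s' > 0" "D > 0" "D' > 0"
    using triangle_denominator_pos abc abc' unfolding s_def s'_def D_def D'_def by auto
  have t0: "(D - 2 * s\<^sup>2) / D = (D' - 2 * s'\<^sup>2) / D'"
    using fun_cong[OF eq, of 0]
    by (simp add: triangle_to_sphere_def Let_def D_def D'_def flip: s_def s'_def)
  have t1: "2 * s * (a - c) / D = 2 * s' * (a' - c') / D'"
    using fun_cong[OF eq, of 1]
    by (simp add: triangle_to_sphere_def Let_def D_def D'_def flip: s_def s'_def)
  have t2: "2 * s * (b - c) / D = 2 * s' * (b' - c') / D'"
    using fun_cong[OF eq, of 2]
    by (simp add: triangle_to_sphere_def Let_def D_def D'_def flip: s_def s'_def)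
  have w: "2 * s\<^sup>2 / D = 2 * s'\<^sup>2 / D'"
    using t0 pos by (simp add: diff_divide_distrib)
  have ratio: "2 * s * u / D / (2 * s\<^sup>2 / D) = u / s" "2 * s' * u / D' / (2 * s'\<^sup>2 / D') = u / s'" for u
    using pos by (simp_all add: power2_eq_square)
  have r1: "(a - c) / s = (a' - c') / s'"
    using ratio[of "a - c"] ratio[of "a' - c'"] t1 w by metis
  have r2: "(b - c) / s = (b' - c') / s'"
    using ratio[of "b - c"] ratio[of "b' - c'"] t2 w by metis
  have norm: "min ((a - c) / s) (min ((b - c) / s) 0) = 1 - c / s"
    "min ((a' - c') / s') (min ((b' - c') / s') 0) = 1 - c' / s'"
    using pos unfolding s_def s'_def by (auto simp: min_def field_simps)
  have r3: "c / s = c' / s'"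
    using norm r1 r2 by simp
  have "1 / s = (a - c) / s + (b - c) / s + 3 * (c / s)"
    using abc(1) by (simp add: field_simps flip: add_divide_distrib)
  moreover have "1 / s' = (a' - c') / s' + (b' - c') / s' + 3 * (c' / s')"
    using abc'(1) by (simp add: field_simps flip: add_divide_distrib)
  ultimately have "1 / s = 1 / s'"
    using r1 r2 r3 by metis
  then have "s = s'"
    by simp
  then show ?thesis
    using r1 r2 r3 pos by simp
qed

text \<open>All quotients are homogeneous of degree 0, so preimages may be sought among unnormalized
  coordinates.\<close>

lemma triangle_to_sphere_scale:
  assumes "k > 0"
  shows "triangle_to_sphere (a / k) (b / k) (c / k) = triangle_to_sphere a b c"
proof -
  have m: "min (a / k) (min (b / k) (c / k)) = min a (min b c) / k"
    using assms by (simp add: min_divide_distrib_right)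
  have q: "(a / k - c / k)\<^sup>2 = (a - c)\<^sup>2 / k\<^sup>2" "(b / k - c / k)\<^sup>2 = (b - c)\<^sup>2 / k\<^sup>2"
    by (simp_all add: power_divide flip: diff_divide_distrib)
  have "(x / k\<^sup>2) / (y / k\<^sup>2) = x / y" "(2 * (x / k) * (a / k - c / k)) = 2 * x * (a - c) / k\<^sup>2"
    "(2 * (x / k) * (b / k - c / k)) = 2 * x * (b - c) / k\<^sup>2" for x y
    using assms by (simp_all add: power2_eq_square flip: diff_divide_distrib)
  then show ?thesis
    unfolding triangle_to_sphere_def Let_def m q power_divide
    by (simp only: flip: add_divide_distrib diff_divide_distrib)
qed

lemma triangle_to_sphere_surj:
  assumes y: "y \<in> topspace (nsphere 2)" and "y 0 \<noteq> 1"
  shows "\<exists>a b c. a + b + c = 1 \<and> a > 0 \<and> b > 0 \<and> c > 0 \<and> triangle_to_sphere a b c = y"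
proof -
  have y1: "(y 0)\<^sup>2 + (y 1)\<^sup>2 + (y 2)\<^sup>2 = 1" and y2: "\<And>i. i > 2 \<Longrightarrow> y i = 0"
    using y topspace_nsphere_2 by auto
  have "(y 0)\<^sup>2 \<le> 1"
    using y1 by (smt (verit) zero_le_power2)
  then have lt: "1 - y 0 > 0"
    using \<open>y 0 \<noteq> 1\<close> abs_square_le_1[of "y 0"] by linarith
  \<comment> \<open>The stereographic projection of \<open>y\<close> from the base point (1, 0,
    0).\<close>
  define P Q where "P = y 1 / (1 - y 0)" and "Q = y 2 / (1 - y 0)"
  \<comment> \<open>The triple \<open>1 - m + P\<close>, \<open>1 - m + Q\<close>,
    \<open>1 - m\<close> has minimum 1 and the prescribed differences \<open>P\<close> and
    \<open>Q\<close> from its last entry; dividing by its sum \<open>N\<close> gives barycentric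
    coordinates.\<close>
  define m where "m = min P (min Q 0)"
  define N where "N = 3 * (1 - m) + P + Q"
  have pos: "1 - m + P \<ge> 1" "1 - m + Q \<ge> 1" "1 - m \<ge> 1"
    by (auto simp: m_def)
  have N: "N > 0"
    using pos by (simp add: N_def)
  have min1: "min (1 - m + P) (min (1 - m + Q) (1 - m)) = 1"
    by (auto simp: m_def min_def)
  have yp: "y 1 = P * (1 - y 0)" "y 2 = Q * (1 - y 0)"
    using lt by (simp_all add: P_def Q_def)
  \<comment> \<open>The sphere equation, written in \<open>P\<close> and \<open>Q\<close>, has the
    positive factor \<open>1 - y 0\<close>, which can be cancelled.\<close>
  have "(1 - y 0) * ((P\<^sup>2 + Q\<^sup>2 + 1) * (1 - y 0) - 2) = 0"
    using y1 unfolding yp by algebra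
  then have D: "(P\<^sup>2 + Q\<^sup>2 + 1) * (1 - y 0) = 2"
    using lt by simp
  have Dpos: "P\<^sup>2 + Q\<^sup>2 + 1 > 0"
    by (smt (verit) zero_le_power2)
  have "triangle_to_sphere ((1 - m + P) / N) ((1 - m + Q) / N) ((1 - m) / N)
      = triangle_to_sphere (1 - m + P) (1 - m + Q) (1 - m)"
    using triangle_to_sphere_scale[OF N] .
  also have "\<dots> = y"
  proof
    fix j :: nat
    consider "j = 0" | "j = 1" | "j = 2" | "j > 2"
      by linarith
    then show "triangle_to_sphere (1 - m + P) (1 - m + Q) (1 - m) j = y j"
    proof cases
      case 1
      have "(P\<^sup>2 + Q\<^sup>2 - 1) / (P\<^sup>2 + Q\<^sup>2 + 1) = y 0"
      proof -
        have "d - 1 = u * (d + 1)" if "(d + 1) * (1 - u) = 2" for d u :: real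
          using that by (simp add: algebra_simps)
        from this[OF D] show ?thesis
          using Dpos by simp
      qed
      then show ?thesis
        unfolding triangle_to_sphere_def Let_def min1 by (simp add: 1)
    next
      case 2
      have "2 * P / (P\<^sup>2 + Q\<^sup>2 + 1) = y 1"
        unfolding yp D[symmetric] using Dpos by simp
      then show ?thesis
        unfolding triangle_to_sphere_def Let_def min1 by (simp add: 2)
    next
      case 3
      have "2 * Q / (P\<^sup>2 + Q\<^sup>2 + 1) = y 2"
        unfolding yp D[symmetric] using Dpos by simp
      then show ?thesis
        unfolding triangle_to_sphere_def Let_def min1 by (simp add: 3)
    next
      case 4
      then show ?thesis
        by (simp add: triangle_to_sphere_def Let_def y2)
    qed
  qed
  finally have "triangle_to_sphere ((1 - m + P) / N) ((1 - m + Q) / N) ((1 - m) / N) = y" .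
  moreover have "(1 - m + P) / N + (1 - m + Q) / N + (1 - m) / N = 1"
    using N by (simp add: N_def flip: add_divide_distrib)
  ultimately show ?thesis
    using pos N by (intro exI[of _ "(1 - m + P) / N"] exI[of _ "(1 - m + Q) / N"] exI[of _ "(1 - m) / N"]) auto
qed

lemma continuous_on_triangle_to_sphere:
  fixes f g h :: "'b::topological_space \<Rightarrow> real"
  assumes "continuous_on A f" "continuous_on A g" "continuous_on A h"
    and sum: "\<And>x. x \<in> A \<Longrightarrow> f x + g x + h x = 1"
  shows "continuous_on A (\<lambda>x. triangle_to_sphere (f x) (g x) (h x))"
proof -
  have nz: "(f x - h x)\<^sup>2 + (g x - h x)\<^sup>2 + (min (f x) (min (g x) (h x)))\<^sup>2 \<noteq> 0" if "x \<in> A" for x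
    using triangle_denominator_pos[OF sum[OF that]] by simp
  have "continuous_on A (\<lambda>x. triangle_to_sphere (f x) (g x) (h x) j)" for j
  proof -
    consider "j = 0" | "j = 1" | "j = 2" | "j > 2"
      by linarith
    then show ?thesis
      by cases (simp_all add: triangle_to_sphere_def Let_def, (intro continuous_intros assms ballI nz; simp)+)
  qed
  then show ?thesis
    by (rule continuous_on_coordinatewise_then_product)
qed

subsection \<open>Subcomplexes with top-dimensional complement\<close>

lemma Min_coordinates_nonneg:
  assumes "finite \<tau>" "\<tau> \<noteq> {}" "x \<in> closed_simplex S"
  shows "0 \<le> Min (x ` \<tau>)"
  using assms by (simp add: closed_simplex_def)

lemma support_eq:
  assumes "finite \<tau>" "x \<in> closed_simplex \<tau>" "Min (x ` \<tau>) \<noteq> 0"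
  shows "{v. x v \<noteq> 0} = \<tau>"
proof -
  have "x v \<noteq> 0" if "v \<in> \<tau>" for v
  proof
    assume "x v = 0"
    then have "Min (x ` \<tau>) = 0"
      using assms that by (intro Min_eqI) (auto simp: closed_simplex_def intro!: image_eqI[of _ _ v])
    then show False
      using assms by simp
  qed
  then show ?thesis
    using assms by (auto simp: closed_simplex_def)
qed

text \<open>Equal cardinality of the new simplices forces their proper faces into \<open>L\<close>,
  so \<open>K\<close> arises from \<open>L\<close> by attaching cells of dimension
  \<open>n - 1\<close> along their boundaries. The bound \<open>n \<ge> 2\<close> makes the facets
  nonempty.\<close>

locale cell_attachment =
  fixes K L :: "'a set set" and n :: nat
  assumes K: "simplicial_complex K" and L: "simplicial_complex L" and LK: "L \<subseteq> K"
    and n: "n \<ge> 2" and card_cell: "\<And>\<tau>. \<tau> \<in> K - L \<Longrightarrow> card \<tau> = n"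
begin

lemma finite_cell: "\<tau> \<in> K - L \<Longrightarrow> finite \<tau>"
  using simplicial_complexD(2)[OF K] by blast

lemma cell_nonempty: "\<tau> \<in> K - L \<Longrightarrow> \<tau> \<noteq> {}"
  using simplicial_complexD(3)[OF K] by blast

text \<open>A vanishing coordinate puts the point in a facet; having only \<open>n - 1\<close>
  vertices, that facet belongs to \<open>L\<close>.\<close>

lemma Min_eq_0_imp_subcomplex:
  assumes "\<tau> \<in> K - L" "x \<in> closed_simplex \<tau>" "Min (x ` \<tau>) = 0"
  shows "x \<in> underlying_space L"
proof -
  have "Min (x ` \<tau>) \<in> x ` \<tau>"
    using finite_cell[OF assms(1)] cell_nonempty[OF assms(1)] by (intro Min_in) auto
  then obtain u where u: "u \<in> \<tau>" "x u = 0"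
    using assms(3) by auto
  have card: "card (\<tau> - {u}) = n - 1"
    using card_cell[OF assms(1)] u by simp
  then have "\<tau> - {u} \<noteq> {}"
    using n by (metis One_nat_def card.empty diff_is_0_eq not_less_eq_eq numeral_2_eq_2)
  then have "\<tau> - {u} \<in> K"
    using simplicial_complexD(4)[OF K, of \<tau> "\<tau> - {u}"] assms(1) by blast
  moreover have "card (\<tau> - {u}) \<noteq> n"
    using card n by simp
  ultimately have "\<tau> - {u} \<in> L"
    using card_cell by blast
  moreover have "x \<in> closed_simplex (\<tau> - {u})"
    using u by (intro closed_simplex_face[OF assms(2) finite_cell[OF assms(1)]]) auto
  ultimately show ?thesis
    unfolding underlying_space_def by blast
qed

text \<open>A closed cell meets \<open>L\<close> exactly in its boundary: as \<open>L\<close> is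
  closed under faces, none of its simplices contains \<open>\<tau>\<close>, so a point of
  \<open>L\<close> misses some vertex of \<open>\<tau>\<close>.\<close>

lemma subcomplex_iff:
  assumes "\<tau> \<in> K - L" "x \<in> closed_simplex \<tau>"
  shows "x \<in> underlying_space L \<longleftrightarrow> Min (x ` \<tau>) = 0"
proof
  assume "x \<in> underlying_space L"
  then obtain S where S: "S \<in> L" "x \<in> closed_simplex S"
    unfolding underlying_space_def by blast
  have "\<not> \<tau> \<subseteq> S"
    using simplicial_complexD(4)[OF L S(1), of \<tau>] assms(1) cell_nonempty by blast
  then show "Min (x ` \<tau>) = 0"
    using Min_coordinates_eq_0 finite_cell assms(1) S(2) by metis
qed (use Min_eq_0_imp_subcomplex assms in blast)

text \<open>A point outside \<open>L\<close> is interior to one cell, recovered as its support. This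
  permits definitions on \<open>K\<close> that read the cell off the point.\<close>

lemma cell_cases:
  assumes "x \<in> underlying_space K"
  obtains "x \<in> underlying_space L"
  | \<tau> where "\<tau> \<in> K - L" "x \<in> closed_simplex \<tau>" "{v. x v \<noteq> 0} = \<tau>" "x \<notin> underlying_space L"
proof (cases "x \<in> underlying_space L")
  case False
  obtain \<tau> where \<tau>: "\<tau> \<in> K" "x \<in> closed_simplex \<tau>"
    using assms unfolding underlying_space_def by blast
  then have "\<tau> \<in> K - L"
    using False unfolding underlying_space_def by blast
  moreover from this have "{v. x v \<noteq> 0} = \<tau>"
    using support_eq[OF finite_cell \<tau>(2)] subcomplex_iff[OF _ \<tau>(2)] False by blast
  ultimately show thesis
    using that(2) \<tau>(2) False by blast
qed

text \<open>Pasting along the finite closed cover by \<open>L\<close> and the closed cells, the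
  pieces agreeing on cell boundaries. The factor \<open>Z\<close> carries the time parameter of a
  homotopy.\<close>

lemma continuous_map_by_cells:
  assumes base: "continuous_map (prod_topology Z (top_of_set (underlying_space L))) Y g"
    and cell: "\<And>\<tau>. \<tau> \<in> K - L \<Longrightarrow> continuous_map (prod_topology Z (top_of_set (closed_simplex \<tau>))) Y (f \<tau>)"
    and agree: "\<And>\<tau> t x. \<tau> \<in> K - L \<Longrightarrow> t \<in> topspace Z \<Longrightarrow> x \<in> closed_simplex \<tau> \<Longrightarrow> Min (x ` \<tau>) = 0
                 \<Longrightarrow> f \<tau> (t, x) = g (t, x)"
  shows "continuous_map (prod_topology Z (top_of_set (underlying_space K))) Y
           (\<lambda>(t, x). if x \<in> underlying_space L then g (t, x) else f {v. x v \<noteq> 0} (t, x))"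
    (is "continuous_map ?X Y ?g")
proof -
  \<comment> \<open>The index \<open>None\<close> stands for \<open>L\<close>, and
    \<open>Some \<tau>\<close> for the closed cell \<open>\<tau>\<close>.\<close>
  define T where "T i = topspace Z \<times> (case i of None \<Rightarrow> underlying_space L | Some \<tau> \<Rightarrow> closed_simplex \<tau>)" for i
  define F where "F i = (case i of None \<Rightarrow> g | Some \<tau> \<Rightarrow> f \<tau>)" for i
  have F_eq: "F i (t, x) = ?g (t, x)"
    if i: "i \<in> insert None (Some ` (K - L))" and x: "(t, x) \<in> T i" for i t x
  proof (cases i)
    case None
    then show ?thesis
      using x by (simp add: F_def T_def)
  next
    case (Some \<tau>)
    then have \<tau>: "\<tau> \<in> K - L" "t \<in> topspace Z" "x \<in> closed_simplex \<tau>"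
      using i x by (auto simp: T_def)
    show ?thesis
    proof (cases "x \<in> underlying_space L")
      case True
      then show ?thesis
        using agree[OF \<tau>] subcomplex_iff[OF \<tau>(1,3)] Some by (simp add: F_def)
    next
      case False
      then have "{v. x v \<noteq> 0} = \<tau>"
        using support_eq[OF finite_cell[OF \<tau>(1)] \<tau>(3)] subcomplex_iff[OF \<tau>(1,3)] by blast
      then show ?thesis
        using False Some by (simp add: F_def)
    qed
  qed
  have sub: "S \<subseteq> underlying_space K \<Longrightarrow>
      subtopology ?X (topspace Z \<times> S) = prod_topology Z (top_of_set S)" for S
    by (simp add: subtopology_Times subtopology_subtopology Int_absorb1)
  have LsubK: "underlying_space L \<subseteq> underlying_space K"
    using LK unfolding underlying_space_def by blast
  have csub: "\<tau> \<in> K \<Longrightarrow> closed_simplex \<tau> \<subseteq> underlying_space K" for \<tau>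
    unfolding underlying_space_def by blast
  show ?thesis
  proof (rule pasting_lemma_closed[where I = "insert None (Some ` (K - L))" and T = T and f = F])
    show "finite (insert None (Some ` (K - L)))"
      using simplicial_complexD(1)[OF K] by blast
    fix i assume i: "i \<in> insert None (Some ` (K - L))"
    have "closedin (top_of_set (underlying_space K)) (case i of None \<Rightarrow> underlying_space L | Some \<tau> \<Rightarrow> closed_simplex \<tau>)"
      using i LsubK csub closed_underlying_space[OF L] closed_closed_simplex
      by (cases i) (auto intro!: closed_subset dest!: csub)
    then show "closedin ?X (T i)"
      unfolding T_def by (simp add: closedin_prod_Times_iff)
    show "continuous_map (subtopology ?X (T i)) Y (F i)"
      using i base cell sub[OF LsubK] sub[OF csub] by (auto simp: T_def F_def)
  next
    fix i j z
    assume "i \<in> insert None (Some ` (K - L))" "j \<in> insert None (Some ` (K - L))"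
      "z \<in> topspace ?X \<inter> T i \<inter> T j"
    then show "F i z = F j z"
      using F_eq[of i "fst z" "snd z"] F_eq[of j "fst z" "snd z"] by auto
  next
    fix z assume z: "z \<in> topspace ?X"
    obtain t x where tx: "z = (t, x)"
      by fastforce
    have "t \<in> topspace Z" "x \<in> underlying_space K"
      using z tx by auto
    from this(2) obtain i where i: "i \<in> insert None (Some ` (K - L))" "(t, x) \<in> T i"
    proof (cases rule: cell_cases)
      case 1
      then show ?thesis
        using that[of None] \<open>t \<in> topspace Z\<close> by (simp add: T_def)
    next
      case (2 \<tau>)
      then show ?thesis
        using that[of "Some \<tau>"] \<open>t \<in> topspace Z\<close> by (simp add: T_def)
    qed
    show "\<exists>i. i \<in> insert None (Some ` (K - L)) \<and> z \<in> T i \<and> ?g z = F i z"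
      unfolding tx using i F_eq[OF i] by (intro exI[of _ i]) simp
  qed
qed

subsection \<open>Homotopy extension\<close>

text \<open>Within a cell, the homotopy enlarges the part where all coordinates exceed \<open>t / 2n\<close> until it
  fills the cell, while the remaining collar runs through the given homotopy of the boundary.\<close>

definition shrink :: "'a set \<Rightarrow> real \<Rightarrow> ('a \<Rightarrow> real) \<Rightarrow> 'a \<Rightarrow> real" where
  "shrink \<tau> s x = (\<lambda>u. (x u - s * of_bool (u \<in> \<tau>)) / (1 - real n * s))"

text \<open>Subtracting \<open>s\<close> from each of the \<open>n\<close> coordinates leaves the
  total \<open>1 - n * s\<close>, which the denominator restores to 1.\<close>

lemma shrink_mem:
  assumes "\<tau> \<in> K - L" "x \<in> closed_simplex \<tau>" "s \<le> Min (x ` \<tau>)" "real n * s < 1"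
  shows "shrink \<tau> s x \<in> closed_simplex \<tau>"
proof -
  have "s \<le> x u" if "u \<in> \<tau>" for u
    using Min_le[of "x ` \<tau>" "x u"] finite_cell[OF assms(1)] that assms(3) by (meson finite_imageI imageI order_trans)
  then have "0 \<le> shrink \<tau> s x u" for u
    using assms by (auto simp: shrink_def closed_simplex_def of_bool_def)
  moreover have "sum (shrink \<tau> s x) \<tau> = 1"
  proof -
    have "(\<Sum>u\<in>\<tau>. x u - s * of_bool (u \<in> \<tau>)) = (\<Sum>u\<in>\<tau>. x u - s)"
      by (intro sum.cong) auto
    also have "\<dots> = 1 - real n * s"
      using assms card_cell by (simp add: sum_subtractf closed_simplex_def)
    finally show ?thesis
      using assms by (simp add: shrink_def flip: sum_divide_distrib)
  qed
  ultimately show ?thesis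
    using assms by (simp add: closed_simplex_def shrink_def)
qed

text \<open>For \<open>s\<close> equal to the minimum, \<open>shrink\<close> is the radial
  projection from the barycentre to the boundary; the bound \<open>n * Min < 1\<close> keeps away
  from the barycentre itself.\<close>

lemma shrink_Min_mem:
  assumes "\<tau> \<in> K - L" "x \<in> closed_simplex \<tau>" "real n * Min (x ` \<tau>) < 1"
  shows "shrink \<tau> (Min (x ` \<tau>)) x \<in> underlying_space L"
proof (rule Min_eq_0_imp_subcomplex[OF assms(1)])
  show mem: "shrink \<tau> (Min (x ` \<tau>)) x \<in> closed_simplex \<tau>"
    using shrink_mem assms by blast
  have "Min (x ` \<tau>) \<in> x ` \<tau>"
    using finite_cell[OF assms(1)] cell_nonempty[OF assms(1)] by (intro Min_in) auto
  then obtain u where u: "u \<in> \<tau>" "x u = Min (x ` \<tau>)"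
    by fastforce
  then have "shrink \<tau> (Min (x ` \<tau>)) x u = 0"
    by (simp add: shrink_def)
  then show "Min (shrink \<tau> (Min (x ` \<tau>)) x ` \<tau>) = 0"
    using u mem finite_cell[OF assms(1)] by (intro Min_eqI) (auto simp: closed_simplex_def intro!: image_eqI[of _ _ u])
qed

lemma continuous_on_shrink:
  fixes f :: "'b::topological_space \<Rightarrow> 'a \<Rightarrow> real"
  assumes "continuous_on A s" "continuous_on A f" "\<And>z. z \<in> A \<Longrightarrow> real n * s z < 1"
  shows "continuous_on A (\<lambda>z. shrink \<tau> (s z) (f z))"
proof -
  have "\<forall>z\<in>A. 1 - real n * s z \<noteq> 0"
    using assms(3) by fastforce
  then show ?thesis
    unfolding shrink_def
    by (intro continuous_on_coordinatewise_then_product continuous_on_divide continuous_on_diff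
        continuous_on_mult continuous_on_const assms(1)
        continuous_on_product_then_coordinatewise[OF assms(2)])
qed

proposition homotopy_extension:
  fixes h :: "real \<times> ('a \<Rightarrow> real) \<Rightarrow> 'a \<Rightarrow> real"
  assumes h: "continuous_on ({0..1} \<times> underlying_space L) h"
    and h_mem: "h ` ({0..1} \<times> underlying_space L) \<subseteq> underlying_space K"
    and h0: "\<And>x. x \<in> underlying_space L \<Longrightarrow> h (0, x) = x"
  obtains H where "continuous_on ({0..1} \<times> underlying_space K) H"
    and "H ` ({0..1} \<times> underlying_space K) \<subseteq> underlying_space K"
    and "\<And>x. x \<in> underlying_space K \<Longrightarrow> H (0, x) = x"
    and "\<And>t x. x \<in> underlying_space L \<Longrightarrow> H (t, x) = h (t, x)"
proof -
  \<comment> \<open>In the collar, \<open>h\<close> runs at time \<open>t - 2 * n * Min\<close>,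
    which is \<open>t\<close> on the boundary and 0 at the inner edge; there \<open>h\<close> is the
    identity and the branches agree. The factor 2 keeps \<open>n * s\<close> at most 1/2, so the
    denominator of \<open>shrink\<close> never vanishes.\<close>
  define f where "f \<tau> = (\<lambda>z. if 2 * real n * Min (snd z ` \<tau>) - fst z \<le> 0
      then h (fst z - 2 * real n * Min (snd z ` \<tau>), shrink \<tau> (Min (snd z ` \<tau>)) (snd z))
      else shrink \<tau> (fst z / (2 * real n)) (snd z))" for \<tau>
  let ?I = "top_of_set {0..1::real}"
  let ?Y = "top_of_set (underlying_space K)"
  define H where "H = (\<lambda>(t, x). if x \<in> underlying_space L then h (t, x) else f {v. x v \<noteq> 0} (t, x))"
  have npos: "real n > 0"
    using n by simp
  have "continuous_map (prod_topology ?I ?Y) ?Y H"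
    unfolding H_def
  proof (rule continuous_map_by_cells)
    show "continuous_map (prod_topology ?I (top_of_set (underlying_space L))) ?Y h"
      using h h_mem by auto
  next
    fix \<tau> assume \<tau>: "\<tau> \<in> K - L"
    let ?A = "{0..1::real} \<times> closed_simplex \<tau>"
    note fin = finite_cell[OF \<tau>] cell_nonempty[OF \<tau>]
    have nonneg: "Min (snd z ` \<tau>) \<ge> 0" if "z \<in> ?A" for z
      using that Min_coordinates_nonneg[OF fin] by auto
    have lt1: "real n * Min (snd z ` \<tau>) < 1" if "z \<in> ?A" "2 * real n * Min (snd z ` \<tau>) - fst z \<le> 0" for z
      using that by auto
    have lt2: "real n * (fst z / (2 * real n)) < 1" if "z \<in> ?A" for z
      using that npos by auto
    have contMin: "continuous_on B (\<lambda>z. Min (snd z ` \<tau>))" for B :: "(real \<times> ('a \<Rightarrow> real)) set"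
      by (intro continuous_intros fin)
    have maps: "(fst z - 2 * real n * Min (snd z ` \<tau>), shrink \<tau> (Min (snd z ` \<tau>)) (snd z)) \<in> {0..1} \<times> underlying_space L"
      if z: "z \<in> ?A" "2 * real n * Min (snd z ` \<tau>) - fst z \<le> 0" for z
    proof -
      have "0 \<le> 2 * real n * Min (snd z ` \<tau>)"
        using nonneg[OF z(1)] by simp
      then show ?thesis
        using shrink_Min_mem[OF \<tau>, of "snd z"] z lt1[OF z] by auto
    qed
    have "continuous_on ?A (f \<tau>)"
      unfolding f_def
    proof (rule continuous_on_cases_le)
      show "continuous_on {z \<in> ?A. 2 * real n * Min (snd z ` \<tau>) - fst z \<le> 0}
          (\<lambda>z. h (fst z - 2 * real n * Min (snd z ` \<tau>), shrink \<tau> (Min (snd z ` \<tau>)) (snd z)))"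
        using maps lt1
        by (intro continuous_on_compose2[OF h] continuous_intros contMin continuous_on_shrink) auto
      show "continuous_on {z \<in> ?A. 0 \<le> 2 * real n * Min (snd z ` \<tau>) - fst z} (\<lambda>z. shrink \<tau> (fst z / (2 * real n)) (snd z))"
        using lt2 npos by (intro continuous_on_shrink continuous_intros) auto
      show "continuous_on ?A (\<lambda>z. 2 * real n * Min (snd z ` \<tau>) - fst z)"
        by (intro continuous_intros contMin)
      show "h (fst z - 2 * real n * Min (snd z ` \<tau>), shrink \<tau> (Min (snd z ` \<tau>)) (snd z))
          = shrink \<tau> (fst z / (2 * real n)) (snd z)"
        if z: "z \<in> ?A" "2 * real n * Min (snd z ` \<tau>) - fst z = 0" for z
      proof -
        have "fst z / (2 * real n) = Min (snd z ` \<tau>)"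
          using z(2) npos by (simp add: field_simps)
        then show ?thesis
          using z(2) maps[OF z(1)] h0 by simp
      qed
    qed
    moreover have "f \<tau> z \<in> underlying_space K" if z: "z \<in> ?A" for z
    proof (cases "2 * real n * Min (snd z ` \<tau>) - fst z \<le> 0")
      case True
      then show ?thesis
        using maps[OF z] h_mem by (auto simp: f_def image_subset_iff)
    next
      case False
      then have "fst z / (2 * real n) \<le> Min (snd z ` \<tau>)"
        using npos by (simp add: field_simps)
      then have "shrink \<tau> (fst z / (2 * real n)) (snd z) \<in> closed_simplex \<tau>"
        using shrink_mem[OF \<tau> _ _ lt2[OF z]] z by auto
      then show ?thesis
        using False \<tau> unfolding f_def underlying_space_def by auto
    qed
    ultimately show "continuous_map (prod_topology ?I (top_of_set (closed_simplex \<tau>))) ?Y (f \<tau>)"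
      by auto
    show "f \<tau> (t, x) = h (t, x)" if "t \<in> topspace ?I" "x \<in> closed_simplex \<tau>" "Min (x ` \<tau>) = 0" for t x
      using that by (simp add: f_def shrink_def)
  qed
  moreover have "H (0, x) = x" if x: "x \<in> underlying_space K" for x
    using x
  proof (cases rule: cell_cases)
    case (2 \<tau>)
    \<comment> \<open>An interior point has positive minimum, so at time 0 it falls under the second
      branch, where \<open>shrink\<close> with parameter 0 is the identity.\<close>
    have "Min (x ` \<tau>) > 0"
      using Min_coordinates_nonneg[OF finite_cell[OF 2(1)] cell_nonempty[OF 2(1)] 2(2)]
        subcomplex_iff[OF 2(1,2)] 2(4) by simp
    then have "\<not> 2 * real n * Min (x ` \<tau>) \<le> 0"
      using npos by (simp add: not_le)
    then show ?thesis
      using 2 by (simp add: H_def f_def shrink_def)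
  qed (simp add: H_def h0)
  ultimately show thesis
    using that[of H] by (auto simp: H_def)
qed

end

section \<open>Collapsing a contractible subcomplex to a wedge of spheres\<close>

lemma nsphere_eq_top_of_set: "nsphere d = top_of_set (topspace (nsphere d))"
  unfolding nsphere by (simp add: euclidean_product_topology)

lemma Hausdorff_space_nsphere: "Hausdorff_space (nsphere d)"
  unfolding nsphere by (intro Hausdorff_space_subtopology) (simp add: Hausdorff_space_product_topology)

text \<open>Collapsing the contractible part is a homotopy equivalence, and each triangle becomes a sphere.\<close>

theorem homotopy_equivalent_wedge_of_2_spheres:
  assumes cells: "cell_attachment K L 3" and contr: "contractible (underlying_space L)" and "L \<noteq> {}"
  shows "top_of_set (underlying_space K) homotopy_equivalent_space wedge_of_spheres 2 (card (K - L))"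
proof -
  interpret cell_attachment K L 3
    by (rule cells)
  let ?p = "\<lambda>_::nat. \<lambda>j::nat. if j = 0 then 1 else 0 :: real"
  let ?W = "wedge_of_spheres 2 (card (K - L))"
  have fin: "finite (K - L)"
    using simplicial_complexD(1)[OF K] by blast
  obtain idx where idx: "bij_betw idx (K - L) {..<card (K - L)}"
    using ex_bij_betw_finite_nat[OF fin] by (auto simp: atLeast0LessThan)
  have "\<forall>\<tau>\<in>K - L. \<exists>a b c. \<tau> = {a, b, c} \<and> a \<noteq> b \<and> a \<noteq> c \<and> b \<noteq> c"
    using card_cell by (metis card_3_iff)
  \<comment> \<open>An ordering of the vertices of each cell, which fixes its barycentric
    coordinates for \<open>triangle_to_sphere\<close>.\<close>
  then obtain va vb vc where *: "\<forall>\<tau>\<in>K - L. \<tau> = {va \<tau>, vb \<tau>, vc \<tau>} \<and>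
      va \<tau> \<noteq> vb \<tau> \<and> va \<tau> \<noteq> vc \<tau> \<and> vb \<tau> \<noteq> vc \<tau>"
    unfolding bchoice_iff by blast
  have v: "\<tau> = {va \<tau>, vb \<tau>, vc \<tau>}" if "\<tau> \<in> K - L" for \<tau>
    using bspec[OF * that] by (rule conjunct1)
  have v_ne: "va \<tau> \<noteq> vb \<tau> \<and> va \<tau> \<noteq> vc \<tau> \<and> vb \<tau> \<noteq> vc \<tau>" if "\<tau> \<in> K - L" for \<tau>
    using bspec[OF * that] by (rule conjunct2)
  define F where "F \<tau> x = triangle_to_sphere (x (va \<tau>)) (x (vb \<tau>)) (x (vc \<tau>))" for \<tau> and x :: "'a \<Rightarrow> real"
  have sum1: "x (va \<tau>) + x (vb \<tau>) + x (vc \<tau>) = 1" if "\<tau> \<in> K - L" "x \<in> closed_simplex \<tau>" for \<tau> x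
  proof -
    have "sum x {va \<tau>, vb \<tau>, vc \<tau>} = 1"
      using that v[OF that(1)] by (simp add: closed_simplex_def)
    then show ?thesis
      using v_ne[OF that(1)] by (simp add: add.assoc)
  qed
  have Min3: "Min (x ` \<tau>) = min (x (va \<tau>)) (min (x (vb \<tau>)) (x (vc \<tau>)))" if "\<tau> \<in> K - L" for \<tau> and x :: "'a \<Rightarrow> real"
  proof -
    have "Min (x ` {va \<tau>, vb \<tau>, vc \<tau>}) = min (x (va \<tau>)) (min (x (vb \<tau>)) (x (vc \<tau>)))"
      by simp
    then show ?thesis
      using v[OF that] by simp
  qed
  have interior: "0 < min (x (va \<tau>)) (min (x (vb \<tau>)) (x (vc \<tau>)))"
    if "\<tau> \<in> K - L" "x \<in> closed_simplex \<tau>" "x \<notin> underlying_space L" for \<tau> x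
    using Min_coordinates_nonneg[OF finite_cell[OF that(1)] cell_nonempty[OF that(1)] that(2)]
      subcomplex_iff[OF that(1,2)] that(3) Min3[OF that(1), of x] by linarith
  have F_ne: "F \<tau> x \<noteq> ?p i" if "\<tau> \<in> K - L" "x \<in> closed_simplex \<tau>" "x \<notin> underlying_space L" for \<tau> x i
    using triangle_to_sphere_interior[OF sum1[OF that(1,2)] interior[OF that]]
    unfolding F_def by (metis (full_types))
  \<comment> \<open>The quotient map: \<open>L\<close> goes to the base point and the interior of
    each cell to the sphere numbered by \<open>idx\<close>.\<close>
  define q where "q x = (if x \<in> underlying_space L then None
      else wedge_incl ?p (idx {v. x v \<noteq> 0}) (F {v. x v \<noteq> 0} x))" for x
  have q_cell: "q x = Some (idx \<tau>, F \<tau> x)"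
    if "\<tau> \<in> K - L" "x \<in> closed_simplex \<tau>" "{v. x v \<noteq> 0} = \<tau>" "x \<notin> underlying_space L" for \<tau> x
    using F_ne[OF that(1,2,4)] that(3,4) by (simp add: q_def wedge_incl_def)
  \<comment> \<open>The only fibre with more than one point is \<open>L\<close>, since distinct
    cells go to distinct summands and \<open>F\<close> is injective on interiors.\<close>
  have fibre: "x = y \<or> x \<in> underlying_space L \<and> y \<in> underlying_space L"
    if x: "x \<in> underlying_space K" and y: "y \<in> underlying_space K" and eq: "q x = q y" for x y
    using x
  proof (cases rule: cell_cases)
    case 1
    from y have "y \<in> underlying_space L"
    proof (cases rule: cell_cases)
      case (2 \<tau>)
      then show ?thesis
        using q_cell[OF 2] eq 1 by (simp add: q_def)
    qed
    then show ?thesis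
      using 1 by blast
  next
    case x: (2 \<tau>)
    from y show ?thesis
    proof (cases rule: cell_cases)
      case 1
      then show ?thesis
        using q_cell[OF x] eq by (simp add: q_def)
    next
      case y: (2 \<tau>')
      have "idx \<tau> = idx \<tau>'" and F_eq: "F \<tau> x = F \<tau>' y"
        using q_cell[OF x] q_cell[OF y] eq by auto
      then have \<tau>: "\<tau>' = \<tau>"
        using bij_betw_imp_inj_on[OF idx] x(1) y(1) by (auto dest: inj_onD)
      have "x (va \<tau>) = y (va \<tau>) \<and> x (vb \<tau>) = y (vb \<tau>) \<and> x (vc \<tau>) = y (vc \<tau>)"
      proof (rule triangle_to_sphere_inj)
        show "triangle_to_sphere (x (va \<tau>)) (x (vb \<tau>)) (x (vc \<tau>)) = triangle_to_sphere (y (va \<tau>)) (y (vb \<tau>)) (y (vc \<tau>))"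
          using F_eq unfolding F_def \<tau> .
      qed (use x y \<tau> sum1 interior in auto)
      then have "x u = y u" if "u \<in> \<tau>" for u
        using eqset_imp_iff[OF v[OF x(1)], of u] that by auto
      then have "x u = y u" for u
        using x(2) y(2) unfolding \<tau> closed_simplex_def by (cases "u \<in> \<tau>") auto
      then show ?thesis
        by blast
    qed
  qed
  have W: "?W = wedge {..<card (K - L)} (\<lambda>_. nsphere 2) ?p"
    by (simp add: wedge_of_spheres_def)
  have cont_q: "continuous_map (top_of_set (underlying_space K)) ?W q"
  proof -
    \<comment> \<open>A one-point parameter space turns the pasting lemma for homotopies into one
      for plain maps.\<close>
    let ?Z = "top_of_set {0::real}"
    let ?f = "\<lambda>\<tau> (t, x). wedge_incl ?p (idx \<tau>) (F \<tau> x)"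
    have c1: "continuous_map (prod_topology ?Z (top_of_set (underlying_space K))) ?W
        (\<lambda>(t, x). if x \<in> underlying_space L then (\<lambda>_. None) (t, x) else ?f {v. x v \<noteq> 0} (t, x))"
    proof (rule continuous_map_by_cells)
      show "continuous_map (prod_topology ?Z (top_of_set (underlying_space L))) ?W (\<lambda>_. None)"
        by (simp add: W topspace_wedge)
    next
      fix \<tau> assume \<tau>: "\<tau> \<in> K - L"
      have "continuous_on (closed_simplex \<tau>) (F \<tau>)"
        unfolding F_def using sum1[OF \<tau>]
        by (intro continuous_on_triangle_to_sphere continuous_on_subset[OF continuous_on_product_coordinates]) auto
      moreover have "F \<tau> ` closed_simplex \<tau> \<subseteq> topspace (nsphere 2)"
        using triangle_to_sphere_mem[OF sum1[OF \<tau>]] by (auto simp: F_def)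
      ultimately have "continuous_map (top_of_set (closed_simplex \<tau>)) (nsphere 2) (F \<tau>)"
        by (subst nsphere_eq_top_of_set) (simp add: image_subset_iff_funcset)
      moreover have "continuous_map (nsphere 2) ?W (wedge_incl ?p (idx \<tau>))"
        unfolding W using continuous_map_wedge_incl[of "idx \<tau>" "{..<card (K - L)}" "\<lambda>_. nsphere 2"]
          bij_betw_apply[OF idx \<tau>] by simp
      ultimately have "continuous_map (top_of_set (closed_simplex \<tau>)) ?W (wedge_incl ?p (idx \<tau>) \<circ> F \<tau>)"
        by (rule continuous_map_compose)
      then have "continuous_map (prod_topology ?Z (top_of_set (closed_simplex \<tau>))) ?W
          ((wedge_incl ?p (idx \<tau>) \<circ> F \<tau>) \<circ> snd)"
        by (rule continuous_map_compose[OF continuous_map_snd])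
      then show "continuous_map (prod_topology ?Z (top_of_set (closed_simplex \<tau>))) ?W (?f \<tau>)"
        by (simp add: o_def case_prod_unfold)
      show "?f \<tau> (t, x) = None" if "t \<in> topspace ?Z" "x \<in> closed_simplex \<tau>" "Min (x ` \<tau>) = 0" for t x
      proof -
        have "F \<tau> x = ?p (idx \<tau>)"
          unfolding F_def using triangle_to_sphere_boundary[OF sum1[OF \<tau> that(2)]] Min3[OF \<tau>, of x] that(3) by simp
        then show ?thesis
          by (simp add: wedge_incl_def)
      qed
    qed
    have c2: "continuous_map (top_of_set (underlying_space K))
        (prod_topology ?Z (top_of_set (underlying_space K))) (\<lambda>x. (0, x))"
      by (intro continuous_map_pairedI) auto
    show ?thesis
      by (rule continuous_map_eq[OF continuous_map_compose[OF c2 c1]]) (simp add: q_def)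
  qed
  have surj_q: "q ` underlying_space K = topspace ?W"
  proof
    show "q ` underlying_space K \<subseteq> topspace ?W"
      using continuous_map_image_subset_topspace[OF cont_q] by simp
    show "topspace ?W \<subseteq> q ` underlying_space K"
    proof
      fix w assume w: "w \<in> topspace ?W"
      show "w \<in> q ` underlying_space K"
      proof (cases w)
        case None
        obtain S u where S: "S \<in> L" "u \<in> S"
          using \<open>L \<noteq> {}\<close> simplicial_complexD(3)[OF L] by blast
        then have "{u} \<in> L"
          using simplicial_complexD(4)[OF L] by blast
        moreover have "(\<lambda>v. of_bool (v = u)) \<in> closed_simplex {u}"
          by (simp add: closed_simplex_def)
        ultimately have "(\<lambda>v. of_bool (v = u)) \<in> underlying_space L"
          unfolding underlying_space_def by blast
        then have "q (\<lambda>v. of_bool (v = u)) = None" "(\<lambda>v. of_bool (v = u)) \<in> underlying_space K"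
          using LK unfolding q_def underlying_space_def by auto
        then show ?thesis
          using None by (metis imageI)
      next
        case (Some z)
        then obtain i y where y: "w = Some (i, y)" "i < card (K - L)" "y \<in> topspace (nsphere 2)" "y \<noteq> ?p i"
          using w unfolding W topspace_wedge by (auto simp: wedge_incl_def split: if_splits)
        obtain \<tau> where \<tau>: "\<tau> \<in> K - L" "idx \<tau> = i"
          using idx y(2) by (metis bij_betw_iff_bijections lessThan_iff)
        \<comment> \<open>The base point is the only point of the sphere with coordinate 1 at index
          0, so \<open>y\<close> has a preimage with positive barycentric coordinates.\<close>
        have "y 0 \<noteq> 1"
        proof
          assume y0: "y 0 = 1"
          then have "(y 1)\<^sup>2 + (y 2)\<^sup>2 = 0" and y3: "\<And>j. j > 2 \<Longrightarrow> y j = 0"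
            using y(3) unfolding topspace_nsphere_2 by auto
          then have "y 1 = 0" "y 2 = 0"
            by (simp_all add: sum_power2_eq_zero_iff)
          then have "y j = ?p i j" for j
            using y0 y3[of j] by (cases "j = 0"; cases "j = 1"; cases "j = 2") auto
          then show False
            using y(4) by blast
        qed
        then obtain a b c where abc: "a + b + c = 1" "a > 0" "b > 0" "c > 0" "triangle_to_sphere a b c = y"
          using triangle_to_sphere_surj[OF y(3)] by blast
        define x where "x = (\<lambda>u. if u = va \<tau> then a else if u = vb \<tau> then b else if u = vc \<tau> then c else 0)"
        have x_v: "x (va \<tau>) = a" "x (vb \<tau>) = b" "x (vc \<tau>) = c"
          using v_ne[OF \<tau>(1)] by (auto simp: x_def)
        have x_0: "x u = 0" if "u \<notin> \<tau>" for u
          using eqset_imp_iff[OF v[OF \<tau>(1)], of u] that by (simp add: x_def)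
        have "sum x {va \<tau>, vb \<tau>, vc \<tau>} = 1"
          using v_ne[OF \<tau>(1)] x_v abc by (simp add: add.assoc)
        then have x: "x \<in> closed_simplex \<tau>"
          using v[OF \<tau>(1)] x_0 abc by (simp add: closed_simplex_def) (simp add: x_def)
        have "Min (x ` \<tau>) > 0"
          unfolding Min3[OF \<tau>(1)] x_v using abc by simp
        then have "{u. x u \<noteq> 0} = \<tau>" "x \<notin> underlying_space L"
          using support_eq[OF finite_cell[OF \<tau>(1)] x] subcomplex_iff[OF \<tau>(1) x] by auto
        then have "q x = w"
          using q_cell[OF \<tau>(1) x] \<tau>(2) abc(5) y(1) x_v by (simp add: F_def)
        moreover have "x \<in> underlying_space K"
          using x \<tau>(1) unfolding underlying_space_def by blast
        ultimately show ?thesis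
          by blast
      qed
    qed
  qed
  \<comment> \<open>A contraction of \<open>L\<close> within itself. Its extension \<open>H\<close>
    over \<open>K\<close> sends \<open>L\<close> to a single point at time 1.\<close>
  obtain a and h :: "real \<times> ('a \<Rightarrow> real) \<Rightarrow> 'a \<Rightarrow> real"
    where h: "continuous_on ({0..1} \<times> underlying_space L) h"
      "h ` ({0..1} \<times> underlying_space L) \<subseteq> underlying_space L"
      "\<And>x. h (0, x) = x" "\<And>x. h (1, x) = a"
    using contr unfolding contractible_def homotopic_with_def
    by (auto simp: image_subset_iff_funcset)
  have LsubK: "underlying_space L \<subseteq> underlying_space K"
    using LK unfolding underlying_space_def by blast
  obtain H where H: "continuous_on ({0..1} \<times> underlying_space K) H"
    "H ` ({0..1} \<times> underlying_space K) \<subseteq> underlying_space K"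
    "\<And>x. x \<in> underlying_space K \<Longrightarrow> H (0, x) = x"
    "\<And>t x. x \<in> underlying_space L \<Longrightarrow> H (t, x) = h (t, x)"
    by (rule homotopy_extension[OF h(1) subset_trans[OF h(2) LsubK] h(3)]) blast
  show ?thesis
  proof (rule homotopy_equivalent_quotient)
    show "compact_space (top_of_set (underlying_space K))"
      using compact_underlying_space[OF K] by (simp add: compact_space_subtopology)
    show "Hausdorff_space ?W"
      unfolding W by (intro Hausdorff_space_wedge Hausdorff_space_nsphere base_point_in_nsphere)
    show "continuous_map (prod_topology (top_of_set {0..1}) (top_of_set (underlying_space K)))
        (top_of_set (underlying_space K)) H"
      using H(1,2) by (simp add: image_subset_iff_funcset)
    fix x y
    assume "x \<in> topspace (top_of_set (underlying_space K))" "y \<in> topspace (top_of_set (underlying_space K))"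
      "q x = q y"
    then have xy: "x = y \<or> x \<in> underlying_space L \<and> y \<in> underlying_space L"
      using fibre by simp
    then show "H (1, x) = H (1, y)"
      using H(4) h(4) by auto
    show "q (H (t, x)) = q (H (t, y))" if "t \<in> {0..1}" for t
    proof -
      \<comment> \<open>The contraction never leaves \<open>L\<close>, so \<open>H\<close> carries
        the one nontrivial fibre into itself at every time.\<close>
      have "q (h (t, z)) = None" if "z \<in> underlying_space L" for z
        using h(2) that \<open>t \<in> {0..1}\<close> by (auto simp: q_def image_subset_iff)
      then show ?thesis
        using xy H(4) by auto
    qed
  qed (use cont_q surj_q H in auto)
qed

subsection \<open>Star complexes with triangles\<close>

text \<open>The vertices of this complex are edges of a graph. With \<open>T = {}\<close> only the
  full simplices on the stars and their faces remain, which is the stage reached after all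
  removals.\<close>

definition star_complex :: "'a set set \<Rightarrow> 'a set set set \<Rightarrow> 'a set set set" where
  "star_complex E T = {S. S \<subseteq> E \<and> S \<noteq> {} \<and> ((\<exists>v. \<forall>e\<in>S. v \<in> e) \<or> (\<exists>t\<in>T. S \<subseteq> t))}"

text \<open>For a graph edge \<open>e\<close> and a vertex \<open>z\<close> off it, the sides of the
  graph triangle that cones \<open>e\<close> off to \<open>z\<close>.\<close>

definition triangle :: "'a set \<Rightarrow> 'a \<Rightarrow> 'a set set" where
  "triangle e z = insert e ((\<lambda>u. {u, z}) ` e)"

lemma simplicial_complex_star_complex:
  assumes "finite E"
  shows "simplicial_complex (star_complex E T)"
proof -
  have "finite (star_complex E T)"
    by (rule finite_subset[of _ "Pow E"]) (use assms in \<open>auto simp: star_complex_def\<close>)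
  moreover have "finite S" if "S \<in> star_complex E T" for S
    using that assms finite_subset by (auto simp: star_complex_def)
  moreover have "R \<in> star_complex E T" if "S \<in> star_complex E T" "R \<subseteq> S" "R \<noteq> {}" for R S
    using that unfolding star_complex_def by blast
  moreover have "{} \<notin> star_complex E T"
    by (simp add: star_complex_def)
  ultimately show ?thesis
    unfolding simplicial_complex_def by metis
qed

text \<open>A vertex common to all of \<open>\<rho>\<close> lies in both \<open>{p, q}\<close> and
  \<open>x\<close>, so it is \<open>p\<close>, and \<open>{p, z}\<close> may be added to the star.
  Otherwise \<open>\<rho>\<close> would lie in the unique triangle on \<open>{p, q}\<close>, which
  has no room for \<open>x\<close>.\<close>

lemma star_complex_insert_edge:
  assumes two: "\<And>e. e \<in> E \<Longrightarrow> card e = 2"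
    and pqz: "p \<noteq> q" "z \<noteq> p" "z \<noteq> q" "{p, z} \<in> E"
    and unique: "\<And>t. t \<in> T \<Longrightarrow> {p, q} \<in> t \<Longrightarrow> t = {{p, q}, {p, z}, {q, z}}"
    and \<rho>: "\<rho> \<in> star_complex E T" "{p, q} \<in> \<rho>" "x \<in> \<rho>"
    and x: "x \<noteq> {p, q}" "p \<in> x" "x \<noteq> {p, z}"
  shows "insert {p, z} \<rho> \<in> star_complex E T"
proof -
  have "x \<in> E"
    using \<rho> by (auto simp: star_complex_def)
  then have "q \<notin> x"
    using two[of x] x(1,2) pqz(1) by (auto simp: card_2_iff)
  have "\<forall>e\<in>\<rho>. p \<in> e"
  proof (cases "\<exists>v. \<forall>e\<in>\<rho>. v \<in> e")
    case True
    then obtain v where v: "\<forall>e\<in>\<rho>. v \<in> e"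
      by blast
    have "v \<in> {p, q}" "v \<in> x"
      using bspec[OF v \<rho>(2)] bspec[OF v \<rho>(3)] by simp_all
    then show ?thesis
      using v \<open>q \<notin> x\<close> by auto
  next
    case False
    then obtain t where "t \<in> T" "\<rho> \<subseteq> t"
      using \<rho>(1) unfolding star_complex_def by blast
    then have "x \<in> {{p, q}, {p, z}, {q, z}}"
      using unique \<rho>(2,3) by blast
    then show ?thesis
      using x pqz by auto
  qed
  then have "\<forall>e\<in>insert {p, z} \<rho>. p \<in> e"
    by simp
  then show ?thesis
    using \<rho>(1) pqz(4) unfolding star_complex_def by blast
qed

text \<open>The simplices containing \<open>{p, q}\<close>, other than the triangle, lie in two stars, which are first
  collapsed onto the edges \<open>{p, z}\<close> and \<open>{q, z}\<close> of the triangle.\<close>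

proposition star_complex_remove_edge:
  assumes fin: "finite E" and two: "\<And>e. e \<in> E \<Longrightarrow> card e = 2"
    and pqz: "p \<noteq> q" "z \<noteq> p" "z \<noteq> q" and E: "{p, q} \<in> E" "{p, z} \<in> E" "{q, z} \<in> E"
    and t: "t = {{p, q}, {p, z}, {q, z}}" "t \<in> T"
    and unique: "\<And>t'. t' \<in> T \<Longrightarrow> {p, q} \<in> t' \<Longrightarrow> t' = t"
  shows "top_of_set (underlying_space (star_complex E T)) homotopy_equivalent_space
         top_of_set (underlying_space (star_complex (E - {{p, q}}) (T - {t})))"
proof -
  let ?e = "{p, q}"
  let ?K = "star_complex E T"
  \<comment> \<open>The edges adjacent to \<open>{p, q}\<close> that are not sides of the triangle.
    \<open>D X\<close> is what remains once \<open>{p, q}\<close> no longer shares a simplex with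
    any edge in \<open>X\<close>.\<close>
  define X0 where "X0 = {x \<in> E. x \<noteq> ?e \<and> (p \<in> x \<and> x \<noteq> {p, z} \<or> q \<in> x \<and> x \<noteq> {q, z})}"
  define D where "D X = {\<rho> \<in> ?K. \<forall>x\<in>X. \<not> {?e, x} \<subseteq> \<rho>}" for X
  have K: "simplicial_complex ?K"
    using simplicial_complex_star_complex[OF fin] .
  have D_cx: "simplicial_complex (D X)" for X
    using K unfolding simplicial_complex_def D_def by auto
  have ne: "{p, z} \<noteq> ?e" "{q, z} \<noteq> ?e" "{p, z} \<notin> X0" "{q, z} \<notin> X0"
    using pqz by (auto simp: X0_def doubleton_eq_iff)
  have D_K: "\<rho> \<in> ?K" if "\<rho> \<in> D X" for \<rho> X
    using that by (simp add: D_def)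
  have uq: "t' = {{p, q}, {p, z}, {q, z}}" if "t' \<in> T" "{p, q} \<in> t'" for t'
    using unique[OF that] t(1) by simp
  have uq': "t' = {{q, p}, {q, z}, {p, z}}" if "t' \<in> T" "{q, p} \<in> t'" for t'
    using uq[of t'] that by (simp add: insert_commute)
  have insD: "insert f \<rho> \<in> D X" if "\<rho> \<in> D X" "insert f \<rho> \<in> ?K" "f \<notin> X0" "f \<noteq> ?e" "X \<subseteq> X0" for f \<rho> X
    using that unfolding D_def by blast
  have "top_of_set (underlying_space ?K) homotopy_equivalent_space top_of_set (underlying_space (D X))"
    if "finite X" "X \<subseteq> X0" for X
    using that
  proof (induction X rule: finite_induct)
    case empty
    then show ?case
      by (simp add: D_def homotopy_equivalent_space_refl)
  next
    case (insert x X)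
    then have x: "x \<in> X0" "X \<subseteq> X0"
      by auto
    have xe: "x \<noteq> ?e"
      using x(1) by (simp add: X0_def)
    have DX: "D (insert x X) = {\<rho> \<in> D X. \<not> {?e, x} \<subseteq> \<rho>}"
      by (auto simp: D_def)
    have "top_of_set (underlying_space (D X)) homotopy_equivalent_space
        top_of_set (underlying_space {\<rho> \<in> D X. \<not> {?e, x} \<subseteq> \<rho>})"
    \<comment> \<open>The simplices to be deleted lie in the star of \<open>p\<close> or of
      \<open>q\<close>; the side of the triangle at that vertex serves as the target of the
      push.\<close>
    proof (cases "p \<in> x \<and> x \<noteq> {p, z}")
      case True
      show ?thesis
      proof (rule homotopy_equivalent_deletion[OF D_cx, where v = "{p, z}"])
        show "insert {p, z} \<rho> \<in> D X" if \<rho>: "\<rho> \<in> D X" "{?e, x} \<subseteq> \<rho>" for \<rho>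
        proof (rule insD[OF \<rho>(1) _ ne(3,1) x(2)])
          show "insert {p, z} \<rho> \<in> ?K"
            by (rule star_complex_insert_edge[OF two pqz E(2) uq
                  D_K[OF \<rho>(1)] subsetD[OF \<rho>(2)] subsetD[OF \<rho>(2)] xe conjunct1[OF True] conjunct2[OF True]])
              simp_all
        qed
      qed (use ne x True in auto)
    next
      case False
      then have "q \<in> x \<and> x \<noteq> {q, z}"
        using x(1) unfolding X0_def mem_Collect_eq by argo
      then have q: "q \<in> x" "x \<noteq> {q, z}"
        by simp_all
      show ?thesis
      proof (rule homotopy_equivalent_deletion[OF D_cx, where v = "{q, z}"])
        show "insert {q, z} \<rho> \<in> D X" if \<rho>: "\<rho> \<in> D X" "{?e, x} \<subseteq> \<rho>" for \<rho>
        proof (rule insD[OF \<rho>(1) _ ne(4,2) x(2)])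
          show "insert {q, z} \<rho> \<in> ?K"
            by (rule star_complex_insert_edge[OF two pqz(1)[symmetric] pqz(3,2) E(3) uq'
                  D_K[OF \<rho>(1)] subsetD[OF \<rho>(2)] subsetD[OF \<rho>(2)] xe[unfolded insert_commute[of p]] q])
              (simp_all add: insert_commute)
        qed
      qed (use ne q in auto)
    qed
    then show ?case
      unfolding DX using insert.IH x(2) homotopy_eqv_trans by blast
  qed
  moreover have "finite X0"
    using fin by (simp add: X0_def)
  ultimately have 1: "top_of_set (underlying_space ?K) homotopy_equivalent_space
      top_of_set (underlying_space (D X0))"
    by blast
  \<comment> \<open>Once all of \<open>X0\<close> is separated from \<open>{p, q}\<close>, the only
    simplices left on it are faces of \<open>t\<close>, so the edge can be pushed onto
    \<open>{p, z}\<close>.\<close>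
  have sub_t: "\<rho> \<subseteq> t" if \<rho>: "\<rho> \<in> D X0" "?e \<in> \<rho>" for \<rho>
  proof (cases "\<exists>v. \<forall>e\<in>\<rho>. v \<in> e")
    case True
    then obtain v where v: "\<forall>e\<in>\<rho>. v \<in> e"
      by blast
    have "v = p \<or> v = q"
      using bspec[OF v \<rho>(2)] by simp
    moreover have "v \<in> x" "x \<in> E" "x \<notin> X0" if "x \<in> \<rho>" for x
      using that \<rho> v by (auto simp: D_def star_complex_def)
    ultimately show ?thesis
      by (fastforce simp: X0_def t(1))
  next
    case False
    then obtain t' where "t' \<in> T" "\<rho> \<subseteq> t'"
      using D_K[OF \<rho>(1)] by (auto simp: star_complex_def)
    then show ?thesis
      using unique[of t'] \<rho>(2) by auto
  qed
  have "top_of_set (underlying_space (D X0)) homotopy_equivalent_space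
      top_of_set (underlying_space {\<rho> \<in> D X0. \<not> {?e} \<subseteq> \<rho>})"
  proof (rule homotopy_equivalent_deletion[OF D_cx, where v = "{p, z}"])
    show "insert {p, z} \<rho> \<in> D X0" if \<rho>: "\<rho> \<in> D X0" "{?e} \<subseteq> \<rho>" for \<rho>
    proof (rule insD[OF \<rho>(1) _ ne(3,1) subset_refl])
      have "insert {p, z} \<rho> \<subseteq> t"
        using sub_t[OF \<rho>(1)] \<rho>(2) t(1) by simp
      then have "\<exists>t\<in>T. insert {p, z} \<rho> \<subseteq> t"
        using t(2) by (rule bexI)
      then show "insert {p, z} \<rho> \<in> ?K"
        using D_K[OF \<rho>(1)] E(2) by (simp add: star_complex_def)
    qed
  qed (use ne in auto)
  moreover have "{\<rho> \<in> D X0. \<not> {?e} \<subseteq> \<rho>} = star_complex (E - {?e}) (T - {t})"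
  proof (rule set_eqI)
    fix \<rho>
    \<comment> \<open>Without \<open>{p, q}\<close>, every face of \<open>t\<close> lies in the star
      of \<open>z\<close>, so dropping \<open>t\<close> from \<open>T\<close> loses no
      simplex.\<close>
    have "\<forall>e\<in>\<rho>. z \<in> e" if "\<rho> \<subseteq> t" "?e \<notin> \<rho>"
      using that t(1) by auto
    then have "(\<exists>v. \<forall>e\<in>\<rho>. v \<in> e) \<or> (\<exists>t'\<in>T. \<rho> \<subseteq> t') \<longleftrightarrow>
        (\<exists>v. \<forall>e\<in>\<rho>. v \<in> e) \<or> (\<exists>t'\<in>T - {t}. \<rho> \<subseteq> t')" if "?e \<notin> \<rho>"
      using that by (metis Diff_iff singletonD)
    then show "\<rho> \<in> {\<rho> \<in> D X0. \<not> {?e} \<subseteq> \<rho>} \<longleftrightarrow> \<rho> \<in> star_complex (E - {?e}) (T - {t})"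
      by (cases "?e \<in> \<rho>") (auto simp: D_def star_complex_def subset_Diff_insert)
  qed
  ultimately show ?thesis
    using homotopy_eqv_trans[OF 1] by simp
qed

text \<open>Remove an edge \<open>e\<close> of least rank first. If it were a side of the triangle
  of another matched edge \<open>e'\<close>, then \<open>rank e' < rank e\<close>; hence it lies in
  its own triangle only and can be collapsed.\<close>

lemma star_complex_remove_matching:
  fixes rank :: "'a set \<Rightarrow> nat"
  assumes "finite E" "\<And>e. e \<in> E \<Longrightarrow> card e = 2" "M \<subseteq> E"
    and "\<And>e. e \<in> M \<Longrightarrow> z e \<notin> e" "\<And>e u. e \<in> M \<Longrightarrow> u \<in> e \<Longrightarrow> {u, z e} \<in> E"
    and "\<And>e u. e \<in> M \<Longrightarrow> u \<in> e \<Longrightarrow> {u, z e} \<in> M \<Longrightarrow> rank e < rank {u, z e}"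
  shows "top_of_set (underlying_space (star_complex E ((\<lambda>e. triangle e (z e)) ` M)))
           homotopy_equivalent_space top_of_set (underlying_space (star_complex (E - M) {}))"
  using assms
proof (induction "card M" arbitrary: E M)
  case 0
  then have "M = {}"
    using finite_subset[of M E] by simp
  then show ?case
    by (simp add: homotopy_equivalent_space_refl)
next
  case (Suc k)
  let ?t = "\<lambda>e. triangle e (z e)"
  have finM: "finite M" "M \<noteq> {}"
    using finite_subset[OF Suc.prems(3,1)] Suc.hyps(2) by auto
  define e where "e = arg_min_on rank M"
  have e: "e \<in> M" "\<And>e'. e' \<in> M \<Longrightarrow> rank e \<le> rank e'"
    using arg_min_if_finite[OF finM, of rank] unfolding e_def by (auto simp: not_less)
  have unique: "e' = e" if "e' \<in> M" "e \<in> ?t e'" for e'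
  proof (rule ccontr)
    assume "e' \<noteq> e"
    then obtain u where "u \<in> e'" "e = {u, z e'}"
      using \<open>e \<in> ?t e'\<close> unfolding triangle_def by auto
    then have "rank e' < rank e"
      using Suc.prems(6)[OF \<open>e' \<in> M\<close>, of u] e(1) by simp
    then show False
      using e(2)[OF \<open>e' \<in> M\<close>] by simp
  qed
  obtain p q where pq: "e = {p, q}" "p \<noteq> q"
    using Suc.prems(2,3) e(1) by (metis card_2_iff subsetD)
  have z: "z e \<noteq> p" "z e \<noteq> q" "{p, z e} \<in> E" "{q, z e} \<in> E"
    using Suc.prems(4)[OF e(1)] Suc.prems(5)[OF e(1)] pq by auto
  have t: "?t e = {{p, q}, {p, z e}, {q, z e}}"
    using pq by (auto simp: triangle_def)
  have 1: "top_of_set (underlying_space (star_complex E (?t ` M))) homotopy_equivalent_space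
      top_of_set (underlying_space (star_complex (E - {{p, q}}) (?t ` M - {?t e})))"
  proof (rule star_complex_remove_edge[OF Suc.prems(1,2) pq(2) z(1,2) _ z(3,4) t])
    show "t' = ?t e" if "t' \<in> ?t ` M" "{p, q} \<in> t'" for t'
      using that unique pq(1) by blast
  qed (use e pq Suc.prems(3) in auto)
  have "?t e' \<noteq> ?t e" if "e' \<in> M - {e}" for e'
    using unique[of e'] that by (auto simp: triangle_def)
  then have 2: "?t ` M - {?t e} = ?t ` (M - {e})"
    by blast
  have 3: "top_of_set (underlying_space (star_complex (E - {e}) (?t ` (M - {e}))))
      homotopy_equivalent_space top_of_set (underlying_space (star_complex (E - {e} - (M - {e})) {}))"
  proof (rule Suc.hyps(1))
    show "k = card (M - {e})"
      using Suc.hyps(2) e(1) finM(1) by simp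
    \<comment> \<open>By the same uniqueness, removing \<open>e\<close> takes no side away from the
      other matched triangles, so the hypotheses persist.\<close>
    show "{u, z e'} \<in> E - {e}" if "e' \<in> M - {e}" "u \<in> e'" for e' u
      using Suc.prems(5)[of e' u] unique[of e'] that by (auto simp: triangle_def)
  qed (use Suc.prems in auto)
  have 4: "E - {e} - (M - {e}) = E - M"
    using e(1) by blast
  show ?case
    using homotopy_eqv_trans[OF 1[folded pq(1), unfolded 2] 3[unfolded 4]] .
qed

subsection \<open>Cliques of line graphs\<close>

text \<open>The cliques of the line graph in terms of the edge set alone, for comparison with
  \<open>star_complex\<close> over the same \<open>E\<close>.\<close>

definition intersecting_complex :: "'a set set \<Rightarrow> 'a set set set" where
  "intersecting_complex E = {S. S \<subseteq> E \<and> S \<noteq> {} \<and> (\<forall>e\<in>S. \<forall>f\<in>S. e \<noteq> f \<longrightarrow> card (e \<inter> f) = 1)}"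

lemma clique_complex_line_graph:
  assumes "finite (edges G)"
  shows "clique_complex (line_graph G) = intersecting_complex (edges G)"
proof -
  have "{e, f} \<in> edges (line_graph G) \<longleftrightarrow> card (e \<inter> f) = 1" if "e \<in> edges G" "f \<in> edges G" for e f
    using that by (auto simp: line_graph_def doubleton_eq_iff Int_commute)
  then have eq: "(\<forall>e\<in>S. \<forall>f\<in>S. e \<noteq> f \<longrightarrow> {e, f} \<in> edges (line_graph G)) \<longleftrightarrow>
      (\<forall>e\<in>S. \<forall>f\<in>S. e \<noteq> f \<longrightarrow> card (e \<inter> f) = 1)" if "S \<subseteq> edges G" for S
    using that by (simp add: subset_iff)
  have verts: "verts (line_graph G) = edges G"
    by (simp add: line_graph_def)
  show ?thesis
    unfolding clique_complex_def intersecting_complex_def verts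
  proof (rule Collect_cong)
    fix S
    show "(S \<subseteq> edges G \<and> finite S \<and> S \<noteq> {} \<and>
        (\<forall>e\<in>S. \<forall>f\<in>S. e \<noteq> f \<longrightarrow> {e, f} \<in> edges (line_graph G))) \<longleftrightarrow>
      (S \<subseteq> edges G \<and> S \<noteq> {} \<and> (\<forall>e\<in>S. \<forall>f\<in>S. e \<noteq> f \<longrightarrow> card (e \<inter> f) = 1))"
      using eq[of S] finite_subset[OF _ assms, of S] by (cases "S \<subseteq> edges G") simp_all
  qed
qed

lemma simplicial_complex_intersecting_complex:
  assumes "finite E"
  shows "simplicial_complex (intersecting_complex E)"
proof -
  have "finite (intersecting_complex E)"
    by (rule finite_subset[of _ "Pow E"]) (use assms in \<open>auto simp: intersecting_complex_def\<close>)
  moreover have "finite S" if "S \<in> intersecting_complex E" for S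
    using that assms finite_subset by (auto simp: intersecting_complex_def)
  moreover have "R \<in> intersecting_complex E" if "S \<in> intersecting_complex E" "R \<subseteq> S" "R \<noteq> {}" for R S
    using that unfolding intersecting_complex_def by (simp add: subset_iff)
  moreover have "{} \<notin> intersecting_complex E"
    by (simp add: intersecting_complex_def)
  ultimately show ?thesis
    unfolding simplicial_complex_def by metis
qed

lemma card_Int_edges:
  assumes "card e = 2" "card f = 2" "e \<noteq> f" "v \<in> e" "v \<in> f"
  shows "card (e \<inter> f) = 1"
proof -
  obtain a b where "e = {v, a}" "f = {v, b}" "a \<noteq> b" "a \<noteq> v" "b \<noteq> v"
    using assms by (auto simp: card_2_iff doubleton_eq_iff)
  then have "e \<inter> f = {v}"
    by auto
  then show ?thesis
    by simp
qed

text \<open>Edges of a star share its centre and two sides of a triangle share a corner; distinct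
  edges share no more than one endpoint.\<close>

lemma star_complex_subset_intersecting_complex:
  assumes two: "\<And>e. e \<in> E \<Longrightarrow> card e = 2"
    and T: "\<And>t. t \<in> T \<Longrightarrow> \<exists>e z. e \<in> E \<and> t = triangle e z \<and> (\<forall>u\<in>e. {u, z} \<in> E)"
  shows "star_complex E T \<subseteq> intersecting_complex E"
proof
  fix S assume S: "S \<in> star_complex E T"
  have "card (e \<inter> f) = 1" if ef: "e \<in> S" "f \<in> S" "e \<noteq> f" for e f
  proof -
    have E: "e \<in> E" "f \<in> E"
      using S ef by (auto simp: star_complex_def)
    have "\<exists>v. v \<in> e \<and> v \<in> f"
    proof (cases "\<exists>v. \<forall>e\<in>S. v \<in> e")
      case False
      then obtain t where "t \<in> T" "S \<subseteq> t"
        using S unfolding star_complex_def by blast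
      then obtain d z where "e \<in> triangle d z" "f \<in> triangle d z"
        using T ef by blast
      then show ?thesis
        using ef(3) unfolding triangle_def by auto
    qed (use ef in blast)
    then show ?thesis
      using card_Int_edges[OF two[OF E(1)] two[OF E(2)] ef(3)] by blast
  qed
  then show "S \<in> intersecting_complex E"
    using S by (simp add: star_complex_def intersecting_complex_def)
qed

text \<open>Given \<open>{p, q}\<close>, an edge avoiding \<open>p\<close> and one avoiding
  \<open>q\<close> must be \<open>{q, z}\<close> and \<open>{p, z}\<close> with the same
  \<open>z\<close>. Any further edge meets all three sides, so it contains two corners and is itself
  a side.\<close>

lemma card_intersecting_no_common_vertex:
  assumes two: "\<And>e. e \<in> S \<Longrightarrow> card e = 2" and "S \<noteq> {}"
    and int: "\<And>e f. e \<in> S \<Longrightarrow> f \<in> S \<Longrightarrow> e \<noteq> f \<Longrightarrow> e \<inter> f \<noteq> {}"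
    and no: "\<nexists>v. \<forall>e\<in>S. v \<in> e"
  shows "card S = 3"
proof -
  obtain p q where pq: "{p, q} \<in> S" "p \<noteq> q"
    using \<open>S \<noteq> {}\<close> two by (metis card_2_iff ex_in_conv)
  obtain f g where f: "f \<in> S" "p \<notin> f" and g: "g \<in> S" "q \<notin> g"
    using no by blast
  have "q \<in> f" "p \<in> g"
    using int[OF pq(1) f(1)] int[OF pq(1) g(1)] f g by auto
  then obtain z where z: "f = {q, z}" "z \<noteq> q"
    using two[OF f(1)] by (auto simp: card_2_iff)
  have "z \<in> g"
    using int[OF f(1) g(1)] z g(2) \<open>q \<in> f\<close> by auto
  have edge_eq: "e = {x, y}" if "e \<in> S" "x \<in> e" "y \<in> e" "x \<noteq> y" for e x y
    using two[OF that(1)] that(2-) by (auto simp: card_2_iff)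
  have zp: "z \<noteq> p"
    using f z by blast
  have g_eq: "g = {p, z}"
    using edge_eq[OF g(1) \<open>p \<in> g\<close> \<open>z \<in> g\<close>] zp by blast
  have "h \<in> {{p, q}, {q, z}, {p, z}}" if h: "h \<in> S" for h
  proof (cases "h = {p, q} \<or> h = {q, z} \<or> h = {p, z}")
    case False
    then have "h \<inter> {p, q} \<noteq> {}" "h \<inter> {q, z} \<noteq> {}" "h \<inter> {p, z} \<noteq> {}"
      using int[OF h] pq(1) f(1) g(1) z(1) g_eq by auto
    then have "{p, q} \<subseteq> h \<or> {q, z} \<subseteq> h \<or> {p, z} \<subseteq> h"
      by blast
    then show ?thesis
      using edge_eq[OF h] pq(2) z(2) zp by blast
  qed blast
  then have "S = {{p, q}, {q, z}, {p, z}}"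
    using pq(1) f(1) g(1) z(1) g_eq by blast
  moreover have "{p, q} \<noteq> {q, z}" "{p, q} \<noteq> {p, z}" "{q, z} \<noteq> {p, z}"
    using pq(2) z(2) zp by (auto simp: doubleton_eq_iff)
  ultimately show ?thesis
    by simp
qed

text \<open>Being outside the star complex excludes a common vertex, so the missing cliques are
  triangles; this provides the uniform cell size of \<open>cell_attachment\<close>.\<close>

lemma card_intersecting_minus_star:
  assumes two: "\<And>e. e \<in> E \<Longrightarrow> card e = 2" and S: "S \<in> intersecting_complex E - star_complex E T"
  shows "card S = 3"
proof (rule card_intersecting_no_common_vertex)
  show "card e = 2" if "e \<in> S" for e
    using S two that by (auto simp: intersecting_complex_def)
  show "e \<inter> f \<noteq> {}" if "e \<in> S" "f \<in> S" "e \<noteq> f" for e f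
    using S that unfolding intersecting_complex_def by fastforce
  show "S \<noteq> {}" "\<nexists>v. \<forall>e\<in>S. v \<in> e"
    using S unfolding intersecting_complex_def star_complex_def by auto
qed

subsection \<open>Complete multipartite graphs\<close>

lemma mem_edges_complete_multipartite:
  "e \<in> edges (complete_multipartite r m) \<longleftrightarrow>
     (\<exists>u v. e = {u, v} \<and> u \<in> verts (complete_multipartite r m) \<and>
            v \<in> verts (complete_multipartite r m) \<and> fst u \<noteq> fst v)"
  by (auto simp: complete_multipartite_def Let_def)

lemma finite_edges_complete_multipartite: "finite (edges (complete_multipartite r m))"
proof (rule finite_subset)
  show "edges (complete_multipartite r m) \<subseteq> Pow (verts (complete_multipartite r m))"
    by (auto simp: mem_edges_complete_multipartite)
  show "finite (Pow (verts (complete_multipartite r m)))"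
    by (simp add: complete_multipartite_def Let_def)
qed

lemma card_edge_complete_multipartite:
  "e \<in> edges (complete_multipartite r m) \<Longrightarrow> card e = 2"
  by (auto simp: mem_edges_complete_multipartite card_2_iff)

theorem theorem3p10:
  fixes r :: nat and m :: "nat \<Rightarrow> nat"
  assumes "r > 2"
    and "\<And>i. i \<in> {1..r} \<Longrightarrow> m i > 0"
  shows "\<exists>k. geometric_realization (clique_complex (line_graph (complete_multipartite r m)))
               homotopy_equivalent_space wedge_of_spheres 2 k"
proof -
  define V where "V = verts (complete_multipartite r m)"
  define E where "E = edges (complete_multipartite r m)"
  \<comment> \<open>One vertex in each of the first three parts; they exist because
    \<open>r > 2\<close> and all parts are nonempty.\<close>
  define a b c :: "nat \<times> nat" where "a = (1, 1)" and "b = (2, 1)" and "c = (3, 1)"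
  have abc: "a \<in> V" "b \<in> V" "c \<in> V"
    using assms(1) assms(2)[of 1] assms(2)[of 2] assms(2)[of 3]
    by (auto simp: V_def complete_multipartite_def Let_def a_def b_def c_def)
  have fst_abc [simp]: "fst a = 1" "fst b = 2" "fst c = 3"
    by (simp_all add: a_def b_def c_def)
  have mem_E: "e \<in> E \<longleftrightarrow> (\<exists>u v. e = {u, v} \<and> u \<in> V \<and> v \<in> V \<and> fst u \<noteq> fst v)" for e
    unfolding E_def V_def by (rule mem_edges_complete_multipartite)
  have pair_E: "{u, v} \<in> E \<longleftrightarrow> u \<in> V \<and> v \<in> V \<and> fst u \<noteq> fst v" for u v
    unfolding mem_E doubleton_eq_iff by metis
  have finE: "finite E"
    unfolding E_def by (rule finite_edges_complete_multipartite)
  have two: "card e = 2" if "e \<in> E" for e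
    using that unfolding E_def by (rule card_edge_complete_multipartite)

  \<comment> \<open>The edges that are never removed: those at \<open>a\<close> and those joining
    \<open>b\<close> to part 1.\<close>
  define E' where "E' = {e \<in> E. a \<in> e \<or> b \<in> e \<and> (\<exists>u\<in>e. fst u = 1)}"
  define M where "M = E - E'"
  define z where "z e = (if \<forall>u\<in>e. fst u \<noteq> 1 then a else if \<exists>u\<in>e. fst u = 2 then c else b)"
    for e :: "(nat \<times> nat) set"
  \<comment> \<open>Sides outside \<open>M\<close> impose no condition. Edges avoiding part 1 come
    last, since the other sides of their triangles contain \<open>a\<close>. A triangle with apex
    \<open>c\<close> has further sides of ranks 1 and 2 over an edge of rank 0; one with apex
    \<open>b\<close> has a side in \<open>E'\<close> and one of rank 2 over an edge of rank at most
    1.\<close>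
  define rank :: "(nat \<times> nat) set \<Rightarrow> nat"
    where "rank e = (if \<forall>u\<in>e. fst u \<noteq> 1 then 2 else if c \<in> e then 1 else 0)" for e
  define T where "T = (\<lambda>e. triangle e (z e)) ` M"
  define K where "K = intersecting_complex E"
  define L where "L = star_complex E T"

  \<comment> \<open>The two kinds of removed edges, with \<open>u\<close> chosen as the endpoint in
    part 1 in the second kind.\<close>
  have M_cases: "(\<exists>u v. e = {u, v} \<and> u \<in> V \<and> v \<in> V \<and> fst u \<noteq> fst v \<and> fst u \<noteq> 1 \<and> fst v \<noteq> 1) \<or>
      (\<exists>u v. e = {u, v} \<and> u \<in> V \<and> v \<in> V \<and> fst u = 1 \<and> u \<noteq> a \<and> fst v \<noteq> 1 \<and> v \<noteq> b)"
    if "e \<in> M" for e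
  proof -
    obtain u v where uv: "e = {u, v}" "u \<in> V" "v \<in> V" "fst u \<noteq> fst v"
      using \<open>e \<in> M\<close> unfolding M_def Diff_iff mem_E by blast
    have not: "u \<noteq> a" "v \<noteq> a" "fst u = 1 \<Longrightarrow> v \<noteq> b" "fst v = 1 \<Longrightarrow> u \<noteq> b"
      using \<open>e \<in> M\<close> uv(1) by (auto simp: M_def E'_def)
    consider "fst u \<noteq> 1" "fst v \<noteq> 1" | "fst u = 1" | "fst v = 1"
      by blast
    then show ?thesis
    proof cases
      case 1
      then show ?thesis
        using uv by blast
    next
      case 2
      then show ?thesis
        using uv not by (intro disjI2 exI[of _ u] exI[of _ v]) auto
    next
      case 3
      then show ?thesis
        using uv not by (intro disjI2 exI[of _ v] exI[of _ u]) auto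
    qed
  qed
  have z_props: "z e \<notin> e \<and> (\<forall>u\<in>e. {u, z e} \<in> E \<and> ({u, z e} \<in> M \<longrightarrow> rank e < rank {u, z e}))"
    if e: "e \<in> M" for e
    using M_cases[OF e]
  proof (elim disjE exE conjE)
    fix u v
    assume uv: "e = {u, v}" "u \<in> V" "v \<in> V" "fst u \<noteq> fst v" "fst u \<noteq> 1" "fst v \<noteq> 1"
    then have "z e = a"
      by (simp add: z_def)
    moreover have "{w, a} \<notin> M" for w
      by (simp add: M_def E'_def)
    moreover have "a \<noteq> u" "a \<noteq> v"
      using uv fst_abc by metis+
    ultimately show ?thesis
      using uv abc by (simp add: pair_E)
  next
    fix u v
    assume uv: "e = {u, v}" "u \<in> V" "v \<in> V" "fst u = 1" "u \<noteq> a" "fst v \<noteq> 1" "v \<noteq> b"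
    show ?thesis
    proof (cases "fst v = 2")
      case True
      then have ne: "c \<noteq> u" "c \<noteq> v"
        using uv by (auto simp: c_def)
      then have "z e = c" "rank e = 0" "rank {u, c} = 1" "rank {v, c} = 2"
        using uv True by (simp_all add: z_def rank_def)
      then show ?thesis
        using uv abc ne True by (simp add: pair_E)
    next
      case False
      then have ne: "b \<noteq> u" "b \<noteq> v"
        using uv by (auto simp: b_def)
      then have "z e = b" "rank e < 2" "rank {v, b} = 2" "{u, b} \<notin> M"
        using uv False by (simp_all add: z_def rank_def M_def E'_def)
      then show ?thesis
        using uv abc ne False by (simp add: pair_E)
    qed
  qed

  have "contractible (underlying_space (star_complex (E - M) {}))"
  proof (rule contractible_cone)
    show "simplicial_complex (star_complex (E - M) {})"
      using simplicial_complex_star_complex finE by blast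
    have ab: "{a, b} \<in> E - M"
      using abc by (simp add: pair_E M_def E'_def)
    then show "{{a, b}} \<in> star_complex (E - M) {}"
      unfolding star_complex_def by blast
    show "insert {a, b} \<rho> \<in> star_complex (E - M) {}" if \<rho>: "\<rho> \<in> star_complex (E - M) {}" for \<rho>
    proof -
      obtain v where v: "\<And>e. e \<in> \<rho> \<Longrightarrow> v \<in> e" and sub: "\<rho> \<subseteq> E'"
        using \<rho> unfolding star_complex_def M_def by blast
      \<comment> \<open>An edge of \<open>E'\<close> at a vertex of part 1 other than
        \<open>a\<close> ends in \<open>b\<close>, and an edge of \<open>E'\<close> avoiding
        \<open>a\<close> joins \<open>b\<close> to part 1. So the common vertex \<open>v\<close> can
        be replaced by \<open>a\<close> or \<open>b\<close>, both endpoints of the apex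
        \<open>{a, b}\<close>.\<close>
      have "(\<forall>e\<in>\<rho>. a \<in> e) \<or> (\<forall>e\<in>\<rho>. b \<in> e)"
      proof (cases "v = b \<or> fst v = 1 \<and> v \<noteq> a")
        case True
        have "b \<in> e" if e: "e \<in> \<rho>" for e
        proof -
          obtain x y where xy: "e = {x, y}" "fst x \<noteq> fst y"
            using e sub unfolding E'_def mem_E by blast
          have "a \<in> e \<or> b \<in> e" "v \<in> e"
            using e sub v by (auto simp: E'_def)
          then show ?thesis
            using xy True by (auto simp: a_def)
        qed
        then show ?thesis
          by blast
      next
        case False
        have "a \<in> e" if "e \<in> \<rho>" for e
        proof (rule ccontr)
          assume "a \<notin> e"
          then have "b \<in> e" "\<exists>u\<in>e. fst u = 1" "v \<in> e" "e \<in> E"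
            using that sub v by (auto simp: E'_def)
          then show False
            using False \<open>a \<notin> e\<close> by (auto simp: mem_E b_def)
        qed
        then show ?thesis
          by blast
      qed
      then have "\<exists>w. \<forall>e\<in>insert {a, b} \<rho>. w \<in> e"
        by blast
      then show ?thesis
        using \<rho> ab by (simp add: star_complex_def)
    qed
  qed
  moreover have "top_of_set (underlying_space L) homotopy_equivalent_space
      top_of_set (underlying_space (star_complex (E - M) {}))"
    unfolding L_def T_def
    by (rule star_complex_remove_matching[where rank = rank]) (use finE two z_props in \<open>auto simp: M_def\<close>)
  ultimately have contr: "contractible (underlying_space L)"
    using homotopy_equivalent_space_contractibility contractible_space_top_of_set by blast

  have K: "simplicial_complex K"
    unfolding K_def using simplicial_complex_intersecting_complex[OF finE] .
  have "{a, b} \<in> E"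
    using abc by (simp add: pair_E)
  then have "L \<noteq> {}"
    unfolding L_def star_complex_def by blast
  have "L \<subseteq> K"
    unfolding L_def K_def
  proof (rule star_complex_subset_intersecting_complex[OF two])
    show "\<exists>e w. e \<in> E \<and> t = triangle e w \<and> (\<forall>u\<in>e. {u, w} \<in> E)" if "t \<in> T" for t
      using that z_props unfolding T_def M_def by blast
  qed
  then have "cell_attachment K L 3"
    using K simplicial_complex_star_complex[OF finE] card_intersecting_minus_star[OF two]
    by unfold_locales (auto simp: K_def L_def)
  then have "top_of_set (underlying_space K) homotopy_equivalent_space wedge_of_spheres 2 (card (K - L))"
    using homotopy_equivalent_wedge_of_2_spheres contr \<open>L \<noteq> {}\<close> by blast
  moreover have "clique_complex (line_graph (complete_multipartite r m)) = K"
    unfolding K_def E_def by (rule clique_complex_line_graph[OF finite_edges_complete_multipartite])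
  ultimately show ?thesis
    using geometric_realization_eq[OF K] by auto
qed

end
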